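(* Let $\mathfrak{g}$ be a complex semi-simple Lie algebra of rank $r$ with weight lattice $X$, and let $V(\lambda)$ be a fixed irreducible representation of $\mathfrak{g}$ (with $\lambda$ dominant) with weight space decomposition $V(\lambda)=\bigoplus_{\nu\in X}V(\lambda)_\nu$ and weight multiplicity function $m_\lambda:X\to\mathbb{N}$, $m_\lambda(\nu)=\dim V(\lambda)_\nu$. Then there are rational functions $A_{\nu,k}(q)\in\mathbb{C}(q_1,\ldots,q_r)$ (for $\nu\in X$, $1\le k\le m_\lambda(\nu)$), not depending on $N$, such that for every $N\in\mathbb{N}$ $$\operatorname{Char} S^N V(\lambda)(ix)=\sum_{\nu\in X} q^{N\nu}\sum_{k=1}^{m_\lambda(\nu)} A_{\nu,k}(q)\cdot p_k(N),$$ where $p_k(N)\in\mathbb{Q}[N]$ is the polynomial of degree $k-1$ given by $$p_k(N)=\binom{N+k-1}{N}.$$ Furthermore, for a weight $\mu\in X$ and $l=0,\ldots,m_\lambda(\mu)-1$ these rational functions are given by $$A_{\mu,m_\lambda(\mu)-l}(q)=\frac{(-1)^l}{l!\,q^{l\mu}}\cdot\frac{d^l}{(dz)^l}\left[\prod_{\nu\in X\setminus\{\mu\}}\frac{1}{(1-q^\nu z)^{m_\lambda(\nu)}}\right]_{z=q^{-\mu}}.$$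
   Context: $\mathbb{N}=\{0,1,2,\ldots\}$. Fix a Borel subalgebra and a Cartan subalgebra $\mathfrak{h}$ of $\mathfrak{g}$; $X=\bigoplus_{i=1}^r\mathbb{Z}\omega_i$ is the weight lattice spanned by the fundamental weights $\omega_i$, $\alpha_1^\vee,\ldots,\alpha_r^\vee$ are the simple coroots, and $\mathfrak{h}_{\mathbb{R}}$ is their real span. $V(\lambda)$ denotes the irreducible representation of highest weight $\lambda\in X^+$ (dominant weights), and $S^N V(\lambda)$ its $N$-th symmetric power. The character of a representation $V$ is $\operatorname{Char}V=\sum_{\mu\in X}m_\mu e^\mu\in\mathbb{Z}[X]$, where $m_\mu$ is the dimension of the $\mu$-weight space, and its Fourier series is $\operatorname{Char}V(ix)=\sum_{\mu\in X}m_\mu e^{i\langle\mu,x\rangle}$ for $x\in\mathfrak{h}_{\mathbb{R}}$. Write $x=\sum_j x_j\alpha_j^\vee$, $q_j=e^{ix_j}$, $q=(q_1,\ldots,q_r)$, and for $\mu=c_1\omega_1+\cdots+c_r\omega_r$ write $q^\mu=q_1^{c_1}\cdots q_r^{c_r}=e^{i\langle\mu,x\rangle}$. Thus $\operatorname{Char}S^NV(\lambda)(ix)$ is regarded as a Laurent polynomial in $\mathbb{Z}[q_1^{\pm1},\ldots,q_r^{\pm1}]\subset\mathbb{C}(q_1,\ldots,q_r)$, and the formula is an identity of rational functions in $q_1,\ldots,q_r$. All sums and products over $X$ are effectively over the finitely many $\nu$ with $m_\lambda(\nu)\neq0$ (an inner sum with $m_\lambda(\nu)=0$ is zero). *)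

theory Defs
  imports Complex_Main "HOL-Library.Multiset" "HOL-Library.Poly_Mapping"
    "HOL-Computational_Algebra.Polynomial" "HOL-Computational_Algebra.Fraction_Field"
begin

subsection \<open>Complex vector spaces\<close>

class complex_vector = ab_group_add +
  fixes scaleC :: "complex \<Rightarrow> 'a \<Rightarrow> 'a"  (infixr \<open>*c\<close> 75)
  assumes scaleC_add_right: "a *c (x + y) = a *c x + a *c y"
    and scaleC_add_left: "(a + b) *c x = a *c x + b *c x"
    and scaleC_scaleC: "a *c (b *c x) = (a * b) *c x"
    and scaleC_one: "1 *c x = x"

global_interpretation cvec: vector_space "scaleC :: complex \<Rightarrow> 'a \<Rightarrow> 'a::complex_vector"
  by unfold_locales (simp_all add: scaleC_add_right scaleC_add_left scaleC_scaleC scaleC_one)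

abbreviation clinear :: "('a::complex_vector \<Rightarrow> 'b::complex_vector) \<Rightarrow> bool" where
  "clinear \<equiv> Vector_Spaces.linear scaleC scaleC"

instantiation complex :: complex_vector
begin
definition scaleC_complex :: "complex \<Rightarrow> complex \<Rightarrow> complex" where
  "scaleC_complex a x = a * x"
instance
  by standard (simp_all add: scaleC_complex_def algebra_simps)
end

instantiation poly_mapping :: (type, complex_vector) complex_vector
begin
lift_definition scaleC_poly_mapping :: "complex \<Rightarrow> ('a \<Rightarrow>\<^sub>0 'b) \<Rightarrow> 'a \<Rightarrow>\<^sub>0 'b"
  is "\<lambda>a p k. a *c p k"
proof -
  fix a :: complex and p :: "'a \<Rightarrow> 'b"
  assume "finite {k. p k \<noteq> 0}"
  then show "finite {k. a *c p k \<noteq> 0}"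
    by (rule rev_finite_subset) auto
qed
instance
  by standard (transfer; simp add: scaleC_add_right scaleC_add_left scaleC_scaleC scaleC_one)+
end

lemma lookup_scaleC [simp]: "Poly_Mapping.lookup (a *c p) k = a *c Poly_Mapping.lookup p k"
  by transfer simp

definition finite_dimensional :: "'a::complex_vector set \<Rightarrow> bool" where
  "finite_dimensional S \<longleftrightarrow> (\<exists>B. finite B \<and> S \<subseteq> cvec.span B)"


subsection \<open>Lie algebras over the complex numbers\<close>

definition lie_algebra :: "('g::complex_vector \<Rightarrow> 'g \<Rightarrow> 'g) \<Rightarrow> bool" where
  "lie_algebra br \<longleftrightarrow>
     (\<forall>x. clinear (br x)) \<and> (\<forall>y. clinear (\<lambda>x. br x y)) \<and>
     (\<forall>x. br x x = 0) \<and>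
     (\<forall>x y z. br x (br y z) + br y (br z x) + br z (br x y) = 0)"

definition lie_subalgebra :: "('g::complex_vector \<Rightarrow> 'g \<Rightarrow> 'g) \<Rightarrow> 'g set \<Rightarrow> bool" where
  "lie_subalgebra br A \<longleftrightarrow> cvec.subspace A \<and> (\<forall>x\<in>A. \<forall>y\<in>A. br x y \<in> A)"

definition lie_ideal :: "('g::complex_vector \<Rightarrow> 'g \<Rightarrow> 'g) \<Rightarrow> 'g set \<Rightarrow> bool" where
  "lie_ideal br I \<longleftrightarrow> cvec.subspace I \<and> (\<forall>x. \<forall>y\<in>I. br x y \<in> I)"

fun derived_series :: "('g::complex_vector \<Rightarrow> 'g \<Rightarrow> 'g) \<Rightarrow> 'g set \<Rightarrow> nat \<Rightarrow> 'g set" where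
  "derived_series br A 0 = A"
| "derived_series br A (Suc n) =
     cvec.span {br x y | x y. x \<in> derived_series br A n \<and> y \<in> derived_series br A n}"

definition solvable :: "('g::complex_vector \<Rightarrow> 'g \<Rightarrow> 'g) \<Rightarrow> 'g set \<Rightarrow> bool" where
  "solvable br A \<longleftrightarrow> (\<exists>n. derived_series br A n = {0})"

definition semisimple_lie_algebra :: "('g::complex_vector \<Rightarrow> 'g \<Rightarrow> 'g) \<Rightarrow> bool" where
  "semisimple_lie_algebra br \<longleftrightarrow> lie_algebra br \<and> finite_dimensional (UNIV :: 'g set) \<and>
     (\<forall>I. lie_ideal br I \<and> solvable br I \<longrightarrow> I = {0})"

definition diagonalizable :: "('a::complex_vector \<Rightarrow> 'a) \<Rightarrow> bool" where
  "diagonalizable f \<longleftrightarrow> cvec.span {x. \<exists>a. f x = a *c x} = UNIV"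

text \<open>The usual definition for semisimple complex Lie algebras: a maximal abelian subalgebra
  all of whose elements are ad-diagonalizable.\<close>

definition cartan_subalgebra :: "('g::complex_vector \<Rightarrow> 'g \<Rightarrow> 'g) \<Rightarrow> 'g set \<Rightarrow> bool" where
  "cartan_subalgebra br h \<longleftrightarrow> cvec.subspace h \<and>
     (\<forall>x\<in>h. \<forall>y\<in>h. br x y = 0) \<and>
     (\<forall>x. (\<forall>t\<in>h. br t x = 0) \<longrightarrow> x \<in> h) \<and>
     (\<forall>t\<in>h. diagonalizable (br t))"

definition borel_subalgebra :: "('g::complex_vector \<Rightarrow> 'g \<Rightarrow> 'g) \<Rightarrow> 'g set \<Rightarrow> bool" where
  "borel_subalgebra br b \<longleftrightarrow> lie_subalgebra br b \<and> solvable br b \<and>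
     (\<forall>b'. lie_subalgebra br b' \<and> solvable br b' \<and> b \<subseteq> b' \<longrightarrow> b' = b)"


subsection \<open>Weights, roots and simple coroots\<close>

text \<open>Elements of the dual of the subspace \<open>h\<close> are functions on the whole space, set to zero
  outside \<open>h\<close> so that equality of functions is equality of functionals.\<close>

definition dual_of :: "'g::complex_vector set \<Rightarrow> ('g \<Rightarrow> complex) set" where
  "dual_of h = {f. (\<forall>x\<in>h. \<forall>y\<in>h. f (x + y) = f x + f y) \<and>
     (\<forall>a. \<forall>x\<in>h. f (a *c x) = a * f x) \<and> (\<forall>x. x \<notin> h \<longrightarrow> f x = 0)}"

text \<open>The simultaneous eigenspace, inside the subspace \<open>W\<close>, of the operators \<open>\<sigma> t\<close>
  (\<open>t \<in> h\<close>) with eigenvalues \<open>f t\<close>.\<close>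

definition weight_space ::
  "'g set \<Rightarrow> 'v::complex_vector set \<Rightarrow> ('g \<Rightarrow> 'v \<Rightarrow> 'v) \<Rightarrow> ('g \<Rightarrow> complex) \<Rightarrow> 'v set" where
  "weight_space h W \<sigma> f = {v \<in> W. \<forall>t\<in>h. \<sigma> t v = f t *c v}"

abbreviation root_space ::
  "('g::complex_vector \<Rightarrow> 'g \<Rightarrow> 'g) \<Rightarrow> 'g set \<Rightarrow> ('g \<Rightarrow> complex) \<Rightarrow> 'g set" where
  "root_space br h f \<equiv> weight_space h UNIV br f"

definition roots :: "('g::complex_vector \<Rightarrow> 'g \<Rightarrow> 'g) \<Rightarrow> 'g set \<Rightarrow> ('g \<Rightarrow> complex) set" where
  "roots br h = {f \<in> dual_of h. f \<noteq> (\<lambda>_. 0) \<and> root_space br h f \<noteq> {0}}"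

definition positive_roots ::
  "('g::complex_vector \<Rightarrow> 'g \<Rightarrow> 'g) \<Rightarrow> 'g set \<Rightarrow> 'g set \<Rightarrow> ('g \<Rightarrow> complex) set" where
  "positive_roots br h b = {f \<in> roots br h. root_space br h f \<subseteq> b}"

definition simple_roots ::
  "('g::complex_vector \<Rightarrow> 'g \<Rightarrow> 'g) \<Rightarrow> 'g set \<Rightarrow> 'g set \<Rightarrow> ('g \<Rightarrow> complex) set" where
  "simple_roots br h b = {f \<in> positive_roots br h b.
     \<not> (\<exists>f1 \<in> positive_roots br h b. \<exists>f2 \<in> positive_roots br h b. f = (\<lambda>t. f1 t + f2 t))}"

definition is_coroot ::
  "('g::complex_vector \<Rightarrow> 'g \<Rightarrow> 'g) \<Rightarrow> 'g set \<Rightarrow> ('g \<Rightarrow> complex) \<Rightarrow> 'g \<Rightarrow> bool" where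
  "is_coroot br h f t \<longleftrightarrow> t \<in> h \<and> f t = 2 \<and>
     (\<exists>x \<in> root_space br h f. \<exists>y \<in> root_space br h (\<lambda>s. - f s). t = br x y)"

text \<open>Elements of the weight lattice \<open>\<Oplus>\<^sub>i \<int> \<omega>\<^sub>i\<close> (\<open>1 \<le> i \<le> r\<close>) are given by their coefficients
  in the basis of fundamental weights; \<open>wt \<omega> c\<close> is the functional with coefficients \<open>c\<close>.\<close>

type_synonym weight = "nat \<Rightarrow>\<^sub>0 int"

definition weight_lattice :: "nat \<Rightarrow> weight set" where
  "weight_lattice r = {c. Poly_Mapping.keys c \<subseteq> {1..r}}"

definition dominant_weights :: "nat \<Rightarrow> weight set" where
  "dominant_weights r = {c \<in> weight_lattice r. \<forall>i. 0 \<le> Poly_Mapping.lookup c i}"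

definition wt :: "(nat \<Rightarrow> 'g \<Rightarrow> complex) \<Rightarrow> weight \<Rightarrow> 'g \<Rightarrow> complex" where
  "wt \<omega> c t = (\<Sum>i\<in>Poly_Mapping.keys c. of_int (Poly_Mapping.lookup c i) * \<omega> i t)"

definition fundamental_weights ::
  "'g::complex_vector set \<Rightarrow> nat \<Rightarrow> (nat \<Rightarrow> 'g) \<Rightarrow> (nat \<Rightarrow> 'g \<Rightarrow> complex) \<Rightarrow> bool" where
  "fundamental_weights h r co \<omega> \<longleftrightarrow>
     (\<forall>i\<in>{1..r}. \<omega> i \<in> dual_of h \<and> (\<forall>j\<in>{1..r}. \<omega> i (co j) = (if i = j then 1 else 0)))"


subsection \<open>Representations\<close>

definition representation ::
  "('g::complex_vector \<Rightarrow> 'g \<Rightarrow> 'g) \<Rightarrow> ('g \<Rightarrow> 'v::complex_vector \<Rightarrow> 'v) \<Rightarrow> bool" where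
  "representation br \<rho> \<longleftrightarrow> finite_dimensional (UNIV :: 'v set) \<and>
     (\<forall>x. clinear (\<rho> x)) \<and> (\<forall>v. clinear (\<lambda>x. \<rho> x v)) \<and>
     (\<forall>x y v. \<rho> (br x y) v = \<rho> x (\<rho> y v) - \<rho> y (\<rho> x v))"

definition irreducible_representation ::
  "('g::complex_vector \<Rightarrow> 'g \<Rightarrow> 'g) \<Rightarrow> ('g \<Rightarrow> 'v::complex_vector \<Rightarrow> 'v) \<Rightarrow> bool" where
  "irreducible_representation br \<rho> \<longleftrightarrow> representation br \<rho> \<and> (\<exists>v::'v. v \<noteq> 0) \<and>
     (\<forall>U. cvec.subspace U \<and> (\<forall>x. \<forall>u\<in>U. \<rho> x u \<in> U) \<longrightarrow> U = {0} \<or> U = UNIV)"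

definition highest_weight ::
  "('g::complex_vector \<Rightarrow> 'g \<Rightarrow> 'g) \<Rightarrow> 'g set \<Rightarrow> 'g set \<Rightarrow> (nat \<Rightarrow> 'g \<Rightarrow> complex) \<Rightarrow>
    ('g \<Rightarrow> 'v::complex_vector \<Rightarrow> 'v) \<Rightarrow> weight \<Rightarrow> bool" where
  "highest_weight br h b \<omega> \<rho> lam \<longleftrightarrow>
     (\<exists>v \<in> weight_space h UNIV \<rho> (wt \<omega> lam). v \<noteq> 0 \<and>
        (\<forall>f \<in> positive_roots br h b. \<forall>x \<in> root_space br h f. \<rho> x v = 0))"

definition weight_mult ::
  "'g set \<Rightarrow> (nat \<Rightarrow> 'g \<Rightarrow> complex) \<Rightarrow> 'v::complex_vector set \<Rightarrow> ('g \<Rightarrow> 'v \<Rightarrow> 'v) \<Rightarrow> weight \<Rightarrow> nat" where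
  "weight_mult h \<omega> W \<sigma> c = cvec.dim (weight_space h W \<sigma> (wt \<omega> c))"


subsection \<open>Symmetric powers\<close>

text \<open>The \<open>N\<close>-th symmetric power of \<open>V\<close> is the vector space freely generated by the symbols
  \<open>v\<^sub>1 \<cdots> v\<^sub>N\<close> (multisets of vectors), modulo multilinearity. The type \<open>symalg\<close> is the direct sum
  of all symmetric powers.\<close>

type_synonym 'v free_sym = "'v multiset \<Rightarrow>\<^sub>0 complex"

abbreviation free_prod :: "'v multiset \<Rightarrow> 'v free_sym" where
  "free_prod M \<equiv> Poly_Mapping.single M 1"

definition multilin_rels :: "'v::complex_vector free_sym set" where
  "multilin_rels = {free_prod (add_mset (a *c u + v) M)
      - a *c free_prod (add_mset u M) - free_prod (add_mset v M) | a u v M. True}"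

definition sym_eq :: "'v::complex_vector free_sym \<Rightarrow> 'v free_sym \<Rightarrow> bool" where
  "sym_eq p q \<longleftrightarrow> p - q \<in> cvec.span multilin_rels"

lemma equivp_sym_eq: "equivp (sym_eq :: 'a::complex_vector free_sym \<Rightarrow> 'a free_sym \<Rightarrow> bool)"
proof (rule equivpI)
  show "reflp (sym_eq :: 'a free_sym \<Rightarrow> 'a free_sym \<Rightarrow> bool)"
    by (simp add: reflp_def sym_eq_def cvec.span_zero)
  show "symp (sym_eq :: 'a free_sym \<Rightarrow> 'a free_sym \<Rightarrow> bool)"
  proof (rule sympI)
    fix p q :: "'a free_sym"
    assume "sym_eq p q"
    then have "- (p - q) \<in> cvec.span multilin_rels"
      unfolding sym_eq_def by (rule cvec.span_neg)
    then show "sym_eq q p"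
      by (simp add: sym_eq_def)
  qed
  show "transp (sym_eq :: 'a free_sym \<Rightarrow> 'a free_sym \<Rightarrow> bool)"
  proof (rule transpI)
    fix p q s :: "'a free_sym"
    assume "sym_eq p q" "sym_eq q s"
    then have "(p - q) + (q - s) \<in> cvec.span multilin_rels"
      unfolding sym_eq_def by (rule cvec.span_add)
    then show "sym_eq p s"
      by (simp add: sym_eq_def)
  qed
qed

quotient_type (overloaded) 'v symalg = "'v::complex_vector free_sym" / sym_eq
  by (rule equivp_sym_eq)

instantiation symalg :: (complex_vector) complex_vector
begin

lift_definition zero_symalg :: "'a symalg" is 0 .

lift_definition plus_symalg :: "'a symalg \<Rightarrow> 'a symalg \<Rightarrow> 'a symalg" is "(+)"
proof -
  fix p p' q q' :: "'a free_sym"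
  assume "sym_eq p p'" "sym_eq q q'"
  then have "(p - p') + (q - q') \<in> cvec.span multilin_rels"
    unfolding sym_eq_def by (rule cvec.span_add)
  then show "sym_eq (p + q) (p' + q')"
    unfolding sym_eq_def by (simp add: algebra_simps)
qed

lift_definition uminus_symalg :: "'a symalg \<Rightarrow> 'a symalg" is uminus
proof -
  fix p p' :: "'a free_sym"
  assume "sym_eq p p'"
  then have "- (p - p') \<in> cvec.span multilin_rels"
    unfolding sym_eq_def by (rule cvec.span_neg)
  then show "sym_eq (- p) (- p')"
    unfolding sym_eq_def by (simp add: algebra_simps)
qed

lift_definition minus_symalg :: "'a symalg \<Rightarrow> 'a symalg \<Rightarrow> 'a symalg" is "(-)"
proof -
  fix p p' q q' :: "'a free_sym"
  assume "sym_eq p p'" "sym_eq q q'"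
  then have "(p - p') - (q - q') \<in> cvec.span multilin_rels"
    unfolding sym_eq_def by (rule cvec.span_diff)
  then show "sym_eq (p - q) (p' - q')"
    unfolding sym_eq_def by (simp add: algebra_simps)
qed

lift_definition scaleC_symalg :: "complex \<Rightarrow> 'a symalg \<Rightarrow> 'a symalg" is scaleC
proof -
  fix a and p p' :: "'a free_sym"
  assume "sym_eq p p'"
  then have "a *c (p - p') \<in> cvec.span multilin_rels"
    unfolding sym_eq_def by (rule cvec.span_scale)
  then show "sym_eq (a *c p) (a *c p')"
    unfolding sym_eq_def by (simp add: cvec.scale_right_diff_distrib)
qed

instance
proof -
  have refl: "sym_eq p p" for p :: "'a free_sym"
    by (simp add: sym_eq_def cvec.span_zero)
  show "OFCLASS('a symalg, complex_vector_class)"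
    by standard
      (transfer; simp add: refl algebra_simps cvec.scale_right_distrib cvec.scale_left_distrib)+
qed

end

lift_definition sym_prod :: "'v::complex_vector multiset \<Rightarrow> 'v symalg" is free_prod .

definition sym_power :: "nat \<Rightarrow> 'v::complex_vector symalg set" where
  "sym_power N = cvec.span {sym_prod M | M. size M = N}"

text \<open>An endomorphism \<open>f\<close> of \<open>V\<close> acts by the Leibniz rule
  \<open>v\<^sub>1 \<cdots> v\<^sub>N \<mapsto> \<Sum>\<^sub>i v\<^sub>1 \<cdots> f(v\<^sub>i) \<cdots> v\<^sub>N\<close>.\<close>

definition leibniz :: "('v \<Rightarrow> 'v) \<Rightarrow> 'v multiset \<Rightarrow> 'v free_sym" where
  "leibniz f M = (\<Sum>v\<in>#M. free_prod (add_mset (f v) (M - {#v#})))"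

definition free_action :: "('v \<Rightarrow> 'v) \<Rightarrow> 'v free_sym \<Rightarrow> 'v free_sym" where
  "free_action f p = (\<Sum>M\<in>Poly_Mapping.keys p. Poly_Mapping.lookup p M *c leibniz f M)"

lemma free_action_superset:
  assumes "finite S" "Poly_Mapping.keys p \<subseteq> S"
  shows "free_action f p = (\<Sum>M\<in>S. Poly_Mapping.lookup p M *c leibniz f M)"
  unfolding free_action_def using assms
  by (intro sum.mono_neutral_left) (auto simp: in_keys_iff)

lemma clinear_free_action: "clinear (free_action f)"
proof unfold_locales
  fix p q :: "'a free_sym" and a :: complex
  let ?S = "Poly_Mapping.keys p \<union> Poly_Mapping.keys q \<union> Poly_Mapping.keys (p + q)"
  have "free_action f (p + q) = (\<Sum>M\<in>?S. Poly_Mapping.lookup (p + q) M *c leibniz f M)"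
    by (rule free_action_superset) auto
  also have "\<dots> = (\<Sum>M\<in>?S. Poly_Mapping.lookup p M *c leibniz f M) + (\<Sum>M\<in>?S. Poly_Mapping.lookup q M *c leibniz f M)"
    by (simp add: lookup_add cvec.scale_left_distrib sum.distrib)
  also have "\<dots> = free_action f p + free_action f q"
    by (subst (1 2) free_action_superset[of ?S, symmetric]) auto
  finally show "free_action f (p + q) = free_action f p + free_action f q" .
  have "Poly_Mapping.keys (a *c p) \<subseteq> Poly_Mapping.keys p"
    by (auto simp: in_keys_iff)
  then have "free_action f (a *c p) = (\<Sum>M\<in>Poly_Mapping.keys p. Poly_Mapping.lookup (a *c p) M *c leibniz f M)"
    by (intro free_action_superset) auto
  also have "\<dots> = a *c free_action f p"
    by (simp add: free_action_def cvec.scale_sum_right scaleC_complex_def)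
  finally show "free_action f (a *c p) = a *c free_action f p" .
qed

lemma free_action_free_prod: "free_action f (free_prod M) = leibniz f M"
  by (simp add: free_action_def)

lemma leibniz_add_mset:
  "leibniz f (add_mset u M) = free_prod (add_mset (f u) M)
     + (\<Sum>w\<in>#M. free_prod (add_mset u (add_mset (f w) (M - {#w#}))))"
proof -
  have "image_mset (\<lambda>w. free_prod (add_mset (f w) (add_mset u M - {#w#}))) M
      = image_mset (\<lambda>w. free_prod (add_mset u (add_mset (f w) (M - {#w#})))) M"
  proof (rule image_mset_cong)
    fix w assume "w \<in># M"
    then have "add_mset u M - {#w#} = add_mset u (M - {#w#})"
      by (metis add_mset_commute add_mset_remove_trivial insert_DiffM)
    then show "free_prod (add_mset (f w) (add_mset u M - {#w#}))
        = free_prod (add_mset u (add_mset (f w) (M - {#w#})))"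
      by (simp add: add_mset_commute)
  qed
  then show ?thesis
    by (simp add: leibniz_def)
qed

lemma free_action_rels:
  assumes f: "clinear f" and p: "p \<in> cvec.span multilin_rels"
  shows "free_action f p \<in> cvec.span multilin_rels"
proof -
  interpret D: Vector_Spaces.linear scaleC scaleC "free_action f" by (rule clinear_free_action)
  interpret F: Vector_Spaces.linear scaleC scaleC f by (rule f)
  let ?R = "\<lambda>a u v M. free_prod (add_mset (a *c u + v) M)
      - a *c free_prod (add_mset u M) - free_prod (add_mset v M) :: 'a free_sym"
  have R: "?R a u v M \<in> cvec.span multilin_rels" for a u v and M :: "'a multiset"
    by (rule cvec.span_base) (auto simp: multilin_rels_def)
  have "free_action f (?R a u v M) \<in> cvec.span multilin_rels" for a u v and M :: "'a multiset"
  proof -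
    have sum_R: "(\<Sum>w\<in>#B. ?R a u v (add_mset (f w) (M - {#w#}))) \<in> cvec.span multilin_rels" for B
      by (induction B) (auto intro: cvec.span_zero cvec.span_add R)
    have sum_split: "(\<Sum>w\<in>#B. ?R a u v (G w))
        = (\<Sum>w\<in>#B. free_prod (add_mset (a *c u + v) (G w)))
          - a *c (\<Sum>w\<in>#B. free_prod (add_mset u (G w)))
          - (\<Sum>w\<in>#B. free_prod (add_mset v (G w)))" for B and G :: "'a \<Rightarrow> 'a multiset"
      by (induction B) (simp_all add: cvec.scale_right_distrib)
    have "free_action f (?R a u v M)
        = ?R a (f u) (f v) M + (\<Sum>w\<in>#M. ?R a u v (add_mset (f w) (M - {#w#})))"
      unfolding D.diff D.scale free_action_free_prod leibniz_add_mset sum_split F.add F.scale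
      by (simp add: cvec.scale_right_distrib algebra_simps)
    then show ?thesis
      using cvec.span_add[OF R[of a "f u" "f v" M] sum_R[of M]] by (simp only:)
  qed
  then have "free_action f ` multilin_rels \<subseteq> cvec.span multilin_rels"
    by (auto simp: multilin_rels_def)
  then have "cvec.span (free_action f ` multilin_rels) \<subseteq> cvec.span multilin_rels"
    using cvec.span_minimal cvec.subspace_span by blast
  moreover have "free_action f p \<in> cvec.span (free_action f ` multilin_rels)"
    using p D.span_image by blast
  ultimately show ?thesis
    by blast
qed

text \<open>Only the first branch matters; a non-linear \<open>f\<close> does not act on the quotient.\<close>

lift_definition sym_action :: "('v::complex_vector \<Rightarrow> 'v) \<Rightarrow> 'v symalg \<Rightarrow> 'v symalg"
  is "\<lambda>f p. if clinear f then free_action f p else 0"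
proof -
  fix f :: "'v \<Rightarrow> 'v" and p q :: "'v free_sym"
  assume "sym_eq p q"
  interpret D: Vector_Spaces.linear scaleC scaleC "free_action f" by (rule clinear_free_action)
  show "sym_eq (if clinear f then free_action f p else 0) (if clinear f then free_action f q else 0)"
    using \<open>sym_eq p q\<close> free_action_rels[of f "p - q"]
    by (auto simp: sym_eq_def D.diff cvec.span_zero)
qed


subsection \<open>Rational functions in \<open>q\<close>\<close>

text \<open>A Laurent polynomial in \<open>q\<^sub>1, q\<^sub>2, \<dots>\<close> is a finitely supported function on exponents, and
  the exponents are elements of the weight lattice: \<open>q\<^bold>^\<mu>\<close> is the monomial with exponent \<open>\<mu>\<close>.
  \<open>rational_functions r\<close> is the field \<open>\<complex>(q\<^sub>1, \<dots>, q\<^sub>r)\<close>, the fraction field of the Laurent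
  polynomials in the first \<open>r\<close> variables only.\<close>

type_synonym ratfun = "(weight \<Rightarrow>\<^sub>0 complex) fract"

definition rational_functions :: "nat \<Rightarrow> ratfun set" where
  "rational_functions r =
     {Fract a b | a b. b \<noteq> 0 \<and> Poly_Mapping.keys a \<subseteq> weight_lattice r \<and> Poly_Mapping.keys b \<subseteq> weight_lattice r}"

definition qpow :: "weight \<Rightarrow> ratfun" where
  "qpow c = Fract (Poly_Mapping.single c 1) 1"

definition ratfun_const :: "complex \<Rightarrow> ratfun" where
  "ratfun_const a = Fract (Poly_Mapping.single 0 a) 1"

definition laurent_to_ratfun :: "(weight \<Rightarrow>\<^sub>0 int) \<Rightarrow> ratfun" where
  "laurent_to_ratfun p = Fract (Poly_Mapping.map of_int p) 1"

definition character ::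
  "nat \<Rightarrow> 'g set \<Rightarrow> (nat \<Rightarrow> 'g \<Rightarrow> complex) \<Rightarrow> 'v::complex_vector set \<Rightarrow> ('g \<Rightarrow> 'v \<Rightarrow> 'v) \<Rightarrow>
    (weight \<Rightarrow>\<^sub>0 int)" where
  "character r h \<omega> W \<sigma> =
     (\<Sum>\<mu> | \<mu> \<in> weight_lattice r \<and> weight_mult h \<omega> W \<sigma> \<mu> \<noteq> 0.
        Poly_Mapping.single \<mu> (int (weight_mult h \<omega> W \<sigma> \<mu>)))"

text \<open>At \<open>x = \<Sum>\<^sub>j x\<^sub>j \<alpha>\<^sub>j\<^sup>\<or>\<close> the monomial \<open>q\<^bold>^\<mu>\<close> with \<open>q\<^sub>j = exp (\<i> x\<^sub>j)\<close> is the Fourier mode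
  \<open>exp (\<i> \<langle>\<mu>, x\<rangle>)\<close>; so the character as a Laurent polynomial in \<open>q\<close> is its Fourier series.\<close>

lemma fourier_mode:
  assumes h: "cvec.subspace h" and co: "\<forall>j\<in>{1..r}. co j \<in> h"
    and \<omega>: "fundamental_weights h r co \<omega>" and \<mu>: "\<mu> \<in> weight_lattice r"
  shows "exp (\<i> * wt \<omega> \<mu> (\<Sum>j\<in>{1..r}. complex_of_real (x j) *c co j))
       = (\<Prod>j\<in>Poly_Mapping.keys \<mu>. exp (\<i> * complex_of_real (x j)) powi Poly_Mapping.lookup \<mu> j)"
proof -
  have omega: "\<omega> i (\<Sum>j\<in>{1..r}. complex_of_real (x j) *c co j) = complex_of_real (x i)"
    if i: "i \<in> {1..r}" for i
  proof -
    have lin: "\<omega> i \<in> dual_of h" and dual: "\<forall>j\<in>{1..r}. \<omega> i (co j) = (if i = j then 1 else 0)"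
      using \<omega> i by (auto simp: fundamental_weights_def)
    have zero: "\<omega> i 0 = 0"
      using lin cvec.subspace_0[OF h] unfolding dual_of_def
      by (metis (mono_tags, lifting) add_cancel_right_left mem_Collect_eq)
    have "J \<subseteq> {1..r} \<Longrightarrow> \<omega> i (\<Sum>j\<in>J. complex_of_real (x j) *c co j)
        = (\<Sum>j\<in>J. complex_of_real (x j) * \<omega> i (co j))" if "finite J" for J
      using that
    proof (induction J)
      case (insert k J)
      have "complex_of_real (x k) *c co k \<in> h" "(\<Sum>j\<in>J. complex_of_real (x j) *c co j) \<in> h"
        using insert.prems co h
        by (auto intro!: cvec.subspace_scale cvec.subspace_sum)
      then show ?case
        using insert lin co by (auto simp: dual_of_def)
    qed (simp add: zero)
    then have "\<omega> i (\<Sum>j\<in>{1..r}. complex_of_real (x j) *c co j)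
        = (\<Sum>j\<in>{1..r}. complex_of_real (x j) * \<omega> i (co j))"
      by simp
    also have "\<dots> = (\<Sum>j\<in>{1..r}. if i = j then complex_of_real (x j) else 0)"
      using dual by (intro sum.cong) auto
    finally show ?thesis
      using i by simp
  qed
  have ks: "Poly_Mapping.keys \<mu> \<subseteq> {1..r}"
    using \<mu> by (simp add: weight_lattice_def)
  have "\<i> * wt \<omega> \<mu> (\<Sum>j\<in>{1..r}. complex_of_real (x j) *c co j)
      = (\<Sum>i\<in>Poly_Mapping.keys \<mu>. of_int (Poly_Mapping.lookup \<mu> i) * (\<i> * complex_of_real (x i)))"
    unfolding wt_def sum_distrib_left using ks omega
    by (intro sum.cong) auto
  then show ?thesis
    by (simp add: exp_sum exp_power_int)
qed


subsection \<open>Differentiation and evaluation of rational functions in one variable\<close>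

lift_definition fract_deriv :: "'a::idom poly fract \<Rightarrow> 'a poly fract"
  is "\<lambda>f. (pderiv (fst f) * snd f - fst f * pderiv (snd f), snd f * snd f)"
proof -
  fix f g :: "'a poly \<times> 'a poly"
  assume "fractrel f g"
  moreover obtain a b c d where fg: "f = (a, b)" "g = (c, d)"
    by (metis surj_pair)
  ultimately have nz: "b \<noteq> 0" "d \<noteq> 0" and eq: "a * d = c * b"
    by auto
  from eq have "pderiv (a * d) = pderiv (c * b)"
    by simp
  then have eq': "pderiv a * d + a * pderiv d = pderiv c * b + c * pderiv b"
    by (simp add: pderiv_mult algebra_simps)
  have "(pderiv a * b - a * pderiv b) * (d * d) - (pderiv c * d - c * pderiv d) * (b * b)
      = b * d * ((pderiv a * d + a * pderiv d) - (pderiv c * b + c * pderiv b))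
        - (a * d - c * b) * (b * pderiv d + d * pderiv b)"
    by (simp add: algebra_simps)
  also have "\<dots> = 0"
    using eq eq' by simp
  finally show "fractrel (pderiv (fst f) * snd f - fst f * pderiv (snd f), snd f * snd f)
      (pderiv (fst g) * snd g - fst g * pderiv (snd g), snd g * snd g)"
    using nz by (simp add: fg)
qed

definition fract_eval :: "'a::field poly fract \<Rightarrow> 'a \<Rightarrow> 'a" where
  "fract_eval f z0 = (THE y. \<exists>a b. f = Fract a b \<and> poly b z0 \<noteq> 0 \<and> y = poly a z0 / poly b z0)"

lemma fract_eval_Fract:
  assumes "poly b z0 \<noteq> 0"
  shows "fract_eval (Fract a b) z0 = poly a z0 / poly b z0"
  unfolding fract_eval_def
proof (rule the_equality)
  fix y assume "\<exists>a' b'. Fract a b = Fract a' b' \<and> poly b' z0 \<noteq> 0 \<and> y = poly a' z0 / poly b' z0"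
  then obtain a' b' where *: "Fract a b = Fract a' b'" "poly b' z0 \<noteq> 0" "y = poly a' z0 / poly b' z0"
    by blast
  then have "b \<noteq> 0" "b' \<noteq> 0"
    using assms by auto
  with * have "a * b' = a' * b"
    by (simp add: eq_fract)
  then have "poly a z0 * poly b' z0 = poly a' z0 * poly b z0"
    by (metis poly_mult)
  then have "poly a' z0 / poly b' z0 = poly a z0 / poly b z0"
    using * assms by (simp add: frac_eq_eq)
  then show "y = poly a z0 / poly b z0"
    using * by simp
qed (use assms in blast)

end

theory Submission
  imports Defs "HOL-Computational_Algebra.Polynomial_FPS"
begin

text \<open>
  If the basis vectors of \<open>V\<close> are weight vectors, then the monomials of degree \<open>N\<close> in these
  vectors are a basis of the symmetric power \<open>S\<^sup>N V\<close> that again consists of weight vectors, and the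
  weights add up. So the character of \<open>S\<^sup>N V\<close> is the complete homogeneous symmetric polynomial
  \<open>h\<^sub>N\<close>, evaluated at the monomials \<open>q\<^sup>\<nu>\<close> with each \<open>\<nu>\<close> repeated \<open>m \<nu>\<close> times
  (\<open>character_sym_power\<close>). The generating function \<open>\<Sum>\<^sub>N h\<^sub>N z\<^sup>N\<close> is the product of the factors
  \<open>1 / (1 - q\<^sup>\<nu> z) ^ m \<nu>\<close>, a rational function of \<open>z\<close> with poles at the distinct points
  \<open>z = q\<^sup>-\<^sup>\<nu>\<close>. In its partial fraction decomposition the coefficient of
  \<open>1 / (1 - q\<^sup>\<nu> z)\<^sup>k\<close> is \<open>A \<nu> k\<close>, and the expansion of that fraction as a binomial series gives
  the factor \<open>p k (N)\<close> times the \<open>N\<close>-th power of \<open>q\<^sup>\<nu>\<close>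
  (\<open>complete_homogeneous_partial_fractions\<close>). The formula for \<open>A \<mu> (m \<mu> - l)\<close> expresses that
  it is the Taylor coefficient of order \<open>l\<close> of the product of all other factors, with respect to
  the local parameter \<open>1 - q\<^sup>\<mu> z\<close> at \<open>z = q\<^sup>-\<^sup>\<mu>\<close>.

  Lie theory enters only through the existence of a basis of weight vectors whose weights are
  integral combinations of the fundamental weights (\<open>weight_basis\<close>). The span of the eigenvectors
  of an element \<open>t\<close> of the Cartan subalgebra is a subrepresentation, because \<open>t\<close> acts
  diagonalisably on the Lie algebra itself, and it contains the highest weight vector. By
  irreducibility it is \<open>V\<close>, so \<open>t\<close> acts diagonalisably on \<open>V\<close>. Commuting
  diagonalisable operators have a common eigenbasis, and coroots have integer eigenvalues by the
  representation theory of \<open>sl\<^sub>2\<close>.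

  That the monomials are independent in the symmetric power (\<open>sym_prod_independent\<close>), which is
  defined by generators and relations, is seen by mapping it to a polynomial ring. The
  partial fraction decomposition (\<open>partial_fractions\<close>) is verified without solving for the
  coefficients: at each pole the Taylor polynomial of the other factors gives the right principal
  part, and the difference of the two sides vanishes because it has too many zeros for its degree.
\<close>

section \<open>Eigenvectors and simultaneous diagonalisation\<close>

text \<open>The operator \<open>f - b\<close> removes the summand of eigenvalue \<open>b\<close> and multiplies each other one
  by the nonzero number \<open>a - b\<close>, which allows induction on the number of eigenvalues.\<close>

lemma eigenvectors_sum_zero:
  assumes f: "clinear f" and A: "finite A"
    and v: "\<And>a. a \<in> A \<Longrightarrow> f (v a) = a *c v a"
    and "(\<Sum>a\<in>A. v a) = 0" and "a \<in> A"
  shows "v a = 0"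
proof -
  interpret f: Vector_Spaces.linear scaleC scaleC f by (rule f)
  have "\<forall>a\<in>A. v a = 0" using A v assms(4)
  proof (induction A arbitrary: v)
    case (insert b A)
    have s: "v b + (\<Sum>a\<in>A. v a) = 0" using insert by simp
    have "f (v b + (\<Sum>a\<in>A. v a)) = b *c v b + (\<Sum>a\<in>A. a *c v a)"
      using insert.prems(1) by (simp add: f.add f.sum)
    then have "b *c v b + (\<Sum>a\<in>A. a *c v a) - b *c (v b + (\<Sum>a\<in>A. v a)) = 0"
      by (simp add: s f.zero)
    then have "(\<Sum>a\<in>A. (a - b) *c v a) = 0"
      by (simp add: cvec.scale_right_distrib cvec.scale_sum_right cvec.scale_left_diff_distrib
          sum_subtractf)
    moreover have "f ((a - b) *c v a) = a *c (a - b) *c v a" if "a \<in> A" for a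
      using insert.prems(1)[of a] that by (simp add: f.scale mult.commute)
    ultimately have "\<forall>a\<in>A. (a - b) *c v a = 0"
      using insert.IH[of "\<lambda>a. (a - b) *c v a"] by blast
    then have "\<forall>a\<in>A. v a = 0"
      using insert.hyps by auto
    then show ?case
      using s by simp
  qed simp
  then show ?thesis using \<open>a \<in> A\<close> by blast
qed

lemma eigenvector_decomposition:
  assumes f: "clinear f" and x: "x \<in> cvec.span {x. \<exists>a. f x = a *c x}"
  obtains A v where "finite A" "\<And>a. f (v a) = a *c v a" "x = (\<Sum>a\<in>A. v a)"
proof -
  interpret f: Vector_Spaces.linear scaleC scaleC f by (rule f)
  have "\<exists>A v. finite A \<and> (\<forall>a. f (v a) = a *c v a) \<and> (\<forall>a. a \<notin> A \<longrightarrow> v a = 0) \<and> x = (\<Sum>a\<in>A. v a)"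
    using x
  proof (induction rule: cvec.span_induct_alt)
    case base
    show ?case by (intro exI[of _ "{}"] exI[of _ "\<lambda>_. 0"]) (simp add: f.zero)
  next
    case (step c x y)
    then obtain b A v where b: "f x = b *c x" and A: "finite A"
      and v: "\<forall>a. f (v a) = a *c v a" "\<forall>a. a \<notin> A \<longrightarrow> v a = 0" "y = (\<Sum>a\<in>A. v a)"
      by blast
    have "(\<Sum>a\<in>insert b A. v a) = y"
      using A v by (cases "b \<in> A") (auto simp: insert_absorb)
    moreover have "(\<Sum>a\<in>insert b A. (v(b := v b + c *c x)) a)
        = (\<Sum>a\<in>insert b A. v a + (if a = b then c *c x else 0))"
      by (intro sum.cong) auto
    ultimately have "(\<Sum>a\<in>insert b A. (v(b := v b + c *c x)) a) = c *c x + y"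
      using A by (simp add: sum.distrib add.commute)
    moreover have "\<forall>a. f ((v(b := v b + c *c x)) a) = a *c (v(b := v b + c *c x)) a"
      using v b by (simp add: f.add f.scale cvec.scale_right_distrib mult.commute)
    ultimately show ?case
      using A v(2) by (intro exI[of _ "insert b A"] exI[of _ "v(b := v b + c *c x)"]) auto
  qed
  then show thesis using that by blast
qed

text \<open>The operators are added one at a time. A joint eigenvector of \<open>T\<close> is decomposed into
  eigenvectors of one further operator \<open>\<sigma> s\<close>. The operators in \<open>T\<close> preserve the eigenspaces of
  \<open>\<sigma> s\<close>, because they commute with it, so the eigenvector equations hold for each component
  separately and the components are joint eigenvectors of \<open>insert s T\<close>.\<close>

lemma simultaneous_eigenvectors_span:
  assumes "finite T" and lin: "\<And>t. t \<in> T \<Longrightarrow> clinear (\<sigma> t)"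
    and diag: "\<And>t. t \<in> T \<Longrightarrow> diagonalizable (\<sigma> t)"
    and comm: "\<And>s t x. s \<in> T \<Longrightarrow> t \<in> T \<Longrightarrow> \<sigma> s (\<sigma> t x) = \<sigma> t (\<sigma> s x)"
  shows "cvec.span {x. \<forall>t\<in>T. \<exists>a. \<sigma> t x = a *c x} = UNIV"
  using assms
proof (induction T)
  case (insert s T)
  let ?E = "\<lambda>T. {x. \<forall>t\<in>T. \<exists>a. \<sigma> t x = a *c x}"
  have IH: "cvec.span (?E T) = UNIV"
    using insert.prems by (intro insert.IH) auto
  have s: "clinear (\<sigma> s)" using insert.prems by simp
  have "x \<in> cvec.span (?E (insert s T))" if x: "x \<in> ?E T" for x
  proof -
    have "x \<in> cvec.span {x. \<exists>a. \<sigma> s x = a *c x}"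
      using insert.prems(2)[of s] by (simp add: diagonalizable_def)
    then obtain A v where A: "finite A" and v: "\<And>a. \<sigma> s (v a) = a *c v a"
      and xs: "x = (\<Sum>a\<in>A. v a)"
      by (rule eigenvector_decomposition[OF s]) blast
    have "v a \<in> ?E (insert s T)" if a: "a \<in> A" for a
    proof -
      have "\<exists>c. \<sigma> t (v a) = c *c v a" if t: "t \<in> T" for t
      proof -
        interpret t: Vector_Spaces.linear scaleC scaleC "\<sigma> t" using insert.prems t by simp
        interpret s: Vector_Spaces.linear scaleC scaleC "\<sigma> s" by (rule s)
        obtain c where c: "\<sigma> t x = c *c x" using x t by blast
        have "(\<Sum>a\<in>A. \<sigma> t (v a) - c *c v a) = 0"
          using c by (simp add: xs t.sum cvec.scale_sum_right sum_subtractf)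
        moreover have "\<sigma> s (\<sigma> t (v a) - c *c v a) = a *c (\<sigma> t (v a) - c *c v a)" for a
        proof -
          have "\<sigma> s (\<sigma> t (v a)) = \<sigma> t (\<sigma> s (v a))" using insert.prems t by simp
          then show ?thesis
            by (simp add: s.diff s.scale v t.scale cvec.scale_right_diff_distrib mult.commute)
        qed
        ultimately have "\<sigma> t (v a) - c *c v a = 0"
          using eigenvectors_sum_zero[OF s A, of "\<lambda>a. \<sigma> t (v a) - c *c v a"] a by blast
        then show ?thesis by auto
      qed
      then show ?thesis using v by auto
    qed
    then show ?thesis
      unfolding xs by (intro cvec.span_sum cvec.span_base)
  qed
  then have "?E T \<subseteq> cvec.span (?E (insert s T))" by blast
  then have "cvec.span (?E T) \<subseteq> cvec.span (?E (insert s T))"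
    by (rule cvec.span_minimal) (rule cvec.subspace_span)
  then show ?case using IH by blast
qed simp

text \<open>Otherwise the \<open>g k\<close> would be infinitely many independent vectors.\<close>

lemma eigenvector_sequence_reaches_zero:
  fixes f :: "'v::complex_vector \<Rightarrow> 'v"
  assumes fd: "finite_dimensional (UNIV :: 'v set)" and f: "clinear f"
    and g: "\<And>k. f (g k) = a k *c g k" and a: "inj (a :: nat \<Rightarrow> complex)"
  shows "\<exists>k. g k = 0"
proof (rule ccontr)
  assume "\<not> (\<exists>k. g k = 0)"
  then have nz: "g k \<noteq> 0" for k by blast
  obtain B :: "'v set" where B: "finite B" "UNIV \<subseteq> cvec.span B"
    using fd by (auto simp: finite_dimensional_def)
  let ?S = "g ` {..card B}"
  have inj: "inj g"
  proof (rule injI)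
    fix i j assume "g i = g j"
    then have "a i *c g i = a j *c g i" using g[of i] g[of j] by metis
    then have "a i = a j" using nz cvec.scale_cancel_right by metis
    then show "i = j" using a by (auto dest: injD)
  qed
  have "cvec.independent ?S"
  proof (rule cvec.independent_if_scalars_zero)
    fix u x assume sum: "(\<Sum>x\<in>?S. u x *c x) = 0" and x: "x \<in> ?S"
    then obtain k where k: "k \<le> card B" "x = g k" by auto
    let ?v = "\<lambda>c. u (g (inv a c)) *c g (inv a c)"
    have "(\<Sum>c\<in>a ` {..card B}. ?v c) = (\<Sum>k\<le>card B. u (g k) *c g k)"
      using a by (simp add: sum.reindex inj_on_subset)
    also have "\<dots> = (\<Sum>x\<in>?S. u x *c x)"
      using inj by (simp add: sum.reindex inj_on_subset)
    finally have "(\<Sum>c\<in>a ` {..card B}. ?v c) = 0" using sum by simp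
    moreover have "f (?v c) = c *c ?v c" if "c \<in> a ` {..card B}" for c
    proof -
      interpret f: Vector_Spaces.linear scaleC scaleC f by (rule f)
      show ?thesis using that a by (auto simp: f.scale g mult.commute)
    qed
    ultimately have "?v (a k) = 0"
      using eigenvectors_sum_zero[OF f, of "a ` {..card B}" ?v "a k"] k by simp
    then show "u x = 0" using a nz k by simp
  qed simp
  then have "card ?S \<le> card B"
    using cvec.independent_span_bound[OF B(1)] B(2) by blast
  then show False using inj by (simp add: card_image inj_on_subset)
qed

lemma eigenvector_sequence_last:
  fixes f :: "'v::complex_vector \<Rightarrow> 'v"
  assumes "finite_dimensional (UNIV :: 'v set)" "clinear f"
    and "\<And>k. f (g k) = a k *c g k" and "inj (a :: nat \<Rightarrow> complex)" and "g 0 \<noteq> 0"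
  obtains n where "g n \<noteq> 0" "g (Suc n) = 0"
proof -
  have ex: "\<exists>k. g k = 0" by (rule eigenvector_sequence_reaches_zero[OF assms(1-4)])
  define k where "k = (LEAST k. g k = 0)"
  have "g k = 0" using ex unfolding k_def by (rule LeastI_ex)
  moreover from this obtain n where n: "k = Suc n" using assms(5) by (cases k) auto
  moreover have "g n \<noteq> 0" using n not_less_Least[of n "\<lambda>k. g k = 0"] k_def by auto
  ultimately show thesis using that by blast
qed


section \<open>Integrality of weights\<close>

text \<open>The raising operator leads from any eigenvector of \<open>H\<close> to one killed by \<open>X\<close>, of some
  eigenvalue \<open>d\<close>. If applying \<open>Y\<close> repeatedly to that vector gives zero for the first time after
  \<open>n + 1\<close> steps, then applying \<open>X\<close> once more gives \<open>(n + 1) (d - n)\<close> times a nonzero vector, so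
  \<open>d = n\<close>.\<close>

lemma sl2_eigenvalue_integral:
  fixes H X Y :: "'v::complex_vector \<Rightarrow> 'v"
  assumes fd: "finite_dimensional (UNIV :: 'v set)"
    and H: "clinear H" and X: "clinear X" and Y: "clinear Y"
    and HX: "\<And>v. H (X v) = X (H v) + 2 *c X v"
    and HY: "\<And>v. H (Y v) = Y (H v) - 2 *c Y v"
    and XY: "\<And>v. X (Y v) = Y (X v) + H v"
    and v: "v \<noteq> 0" "H v = c *c v"
  shows "c \<in> \<int>"
proof -
  interpret X: Vector_Spaces.linear scaleC scaleC X by (rule X)
  interpret Y: Vector_Spaces.linear scaleC scaleC Y by (rule Y)
  have "H ((X ^^ k) v) = (c + 2 * of_nat k) *c (X ^^ k) v" for k
    by (induction k)
      (simp_all add: v HX X.add X.scale cvec.scale_left_distrib distrib_left)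
  moreover have "inj (\<lambda>k. c + 2 * of_nat k)" by (rule injI) simp
  ultimately obtain k where k: "(X ^^ k) v \<noteq> 0" "X ((X ^^ k) v) = 0"
    and Hk: "H ((X ^^ k) v) = (c + 2 * of_nat k) *c (X ^^ k) v"
    using eigenvector_sequence_last[OF fd H, of "\<lambda>k. (X ^^ k) v" "\<lambda>k. c + 2 * of_nat k"] v
    by auto
  define w where "w = (X ^^ k) v"
  define d where "d = c + 2 * of_nat k"
  have HYj: "H ((Y ^^ j) w) = (d - 2 * of_nat j) *c (Y ^^ j) w" for j
    using Hk by (induction j)
      (simp_all add: w_def d_def HY Y.add Y.diff Y.scale cvec.scale_left_distrib
        cvec.scale_left_diff_distrib distrib_left)
  have XYj: "X ((Y ^^ Suc j) w) = (of_nat (Suc j) * (d - of_nat j)) *c (Y ^^ j) w" for j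
  proof (induction j)
    case 0
    show ?case using k Hk by (simp add: XY w_def d_def Y.zero)
  next
    case (Suc j)
    have "X ((Y ^^ Suc (Suc j)) w) = Y (X ((Y ^^ Suc j) w)) + H ((Y ^^ Suc j) w)"
      using XY[of "(Y ^^ Suc j) w"] by simp
    also have "\<dots> = (of_nat (Suc j) * (d - of_nat j)) *c (Y ^^ Suc j) w
        + (d - 2 * of_nat (Suc j)) *c (Y ^^ Suc j) w"
      unfolding Suc HYj by (simp add: Y.scale)
    also have "\<dots> = (of_nat (Suc (Suc j)) * (d - of_nat (Suc j))) *c (Y ^^ Suc j) w"
      unfolding cvec.scale_left_distrib[symmetric] by (simp add: algebra_simps)
    finally show ?case .
  qed
  have "inj (\<lambda>j. d - 2 * of_nat j)" by (rule injI) simp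
  then obtain n where n: "(Y ^^ n) w \<noteq> 0" "(Y ^^ Suc n) w = 0"
    using eigenvector_sequence_last[OF fd H, of "\<lambda>j. (Y ^^ j) w" "\<lambda>j. d - 2 * of_nat j"] HYj k
    by (auto simp: w_def)
  have "of_nat (Suc n) * (d - of_nat n) = 0"
    using XYj[of n] n by (simp add: X.zero del: of_nat_Suc)
  then have "d = of_nat n"
    by (simp del: of_nat_Suc)
  then have "c = of_nat n - 2 * of_nat k"
    by (simp add: d_def algebra_simps)
  then show ?thesis by simp
qed


section \<open>A basis of weight vectors\<close>

lemma representationD:
  "representation br \<rho> \<Longrightarrow> clinear (\<rho> x)" "representation br \<rho> \<Longrightarrow> clinear (\<lambda>x. \<rho> x v)"
  "representation br \<rho> \<Longrightarrow> \<rho> (br x y) v = \<rho> x (\<rho> y v) - \<rho> y (\<rho> x v)"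
  by (auto simp: representation_def)

text \<open>An eigenvector of \<open>br t\<close> acts on the eigenvectors of \<open>\<rho> t\<close> by shifting eigenvalues.
  As such eigenvectors span the Lie algebra, the span of the eigenvectors of \<open>\<rho> t\<close> is stable,
  so by irreducibility it is everything as soon as a single eigenvector exists.\<close>

lemma irreducible_representation_diagonalizable:
  fixes \<rho> :: "'g::complex_vector \<Rightarrow> 'v::complex_vector \<Rightarrow> 'v"
  assumes irr: "irreducible_representation br \<rho>" and diag: "diagonalizable (br t)"
    and v: "v \<noteq> 0" "\<rho> t v = a *c v"
  shows "diagonalizable (\<rho> t)"
proof -
  let ?E = "{x. \<exists>a. \<rho> t x = a *c x}"
  have rep: "representation br \<rho>" using irr by (simp add: irreducible_representation_def)
  note lin = representationD[OF rep]
  interpret t: Vector_Spaces.linear scaleC scaleC "\<rho> t" by (rule lin)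
  have eig: "\<rho> x u \<in> ?E" if u: "u \<in> ?E" and x: "br t x = c *c x" for x u c
  proof -
    obtain d where d: "\<rho> t u = d *c u" using u by blast
    interpret x: Vector_Spaces.linear scaleC scaleC "\<rho> x" by (rule lin)
    interpret u: Vector_Spaces.linear scaleC scaleC "\<lambda>x. \<rho> x u" by (rule lin)
    have "\<rho> t (\<rho> x u) = \<rho> (br t x) u + \<rho> x (\<rho> t u)" by (simp add: lin(3))
    also have "\<dots> = (c + d) *c \<rho> x u"
      by (simp add: x d u.scale x.scale cvec.scale_left_distrib)
    finally show ?thesis by blast
  qed
  have "\<rho> x u \<in> cvec.span ?E" if u: "u \<in> ?E" for x u
  proof -
    interpret u: Vector_Spaces.linear scaleC scaleC "\<lambda>x. \<rho> x u" by (rule lin)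
    have "x \<in> cvec.span {x. \<exists>c. br t x = c *c x}" using diag by (simp add: diagonalizable_def)
    then show ?thesis
    proof (induction rule: cvec.span_induct_alt)
      case base
      show ?case using u.zero cvec.span_zero by metis
    next
      case (step c x y)
      then have "\<rho> x u \<in> cvec.span ?E" using eig[OF u] by (blast intro: cvec.span_base)
      then show ?case using step by (simp add: u.add u.scale cvec.span_add cvec.span_scale)
    qed
  qed
  then have stable: "\<rho> x u \<in> cvec.span ?E" if "u \<in> cvec.span ?E" for x u
  proof -
    interpret x: Vector_Spaces.linear scaleC scaleC "\<rho> x" by (rule lin)
    have "\<rho> x ` ?E \<subseteq> cvec.span ?E"
      using \<open>\<And>x u. u \<in> ?E \<Longrightarrow> \<rho> x u \<in> cvec.span ?E\<close> by blast
    then have "cvec.span (\<rho> x ` ?E) \<subseteq> cvec.span ?E"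
      by (rule cvec.span_minimal) (rule cvec.subspace_span)
    moreover have "\<rho> x u \<in> cvec.span (\<rho> x ` ?E)"
      unfolding x.span_image using that by blast
    ultimately show ?thesis by blast
  qed
  have "cvec.span ?E = {0} \<or> cvec.span ?E = UNIV"
    using irr stable cvec.subspace_span unfolding irreducible_representation_def by blast
  moreover have "v \<in> cvec.span ?E" using v by (blast intro: cvec.span_base)
  ultimately show ?thesis using v by (auto simp: diagonalizable_def)
qed

lemma wt_coroot:
  assumes \<omega>: "fundamental_weights h r co \<omega>" and c: "c \<in> weight_lattice r" and j: "j \<in> {1..r}"
  shows "wt \<omega> c (co j) = of_int (Poly_Mapping.lookup c j)"
proof -
  have "wt \<omega> c (co j) = (\<Sum>i\<in>{1..r}. of_int (Poly_Mapping.lookup c i) * \<omega> i (co j))"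
    unfolding wt_def using c
    by (intro sum.mono_neutral_left) (auto simp: weight_lattice_def in_keys_iff)
  also have "\<dots> = (\<Sum>i\<in>{1..r}. if i = j then of_int (Poly_Mapping.lookup c i) else 0)"
    using \<omega> j by (intro sum.cong) (auto simp: fundamental_weights_def)
  finally show ?thesis using j by simp
qed

lemma wt_eq_iff:
  assumes \<omega>: "fundamental_weights h r co \<omega>" and co: "\<And>j. j \<in> {1..r} \<Longrightarrow> co j \<in> h"
    and c: "c \<in> weight_lattice r" and d: "d \<in> weight_lattice r"
  shows "(\<forall>t\<in>h. wt \<omega> c t = wt \<omega> d t) \<longleftrightarrow> c = d"
proof
  assume eq: "\<forall>t\<in>h. wt \<omega> c t = wt \<omega> d t"
  have "Poly_Mapping.lookup c j = Poly_Mapping.lookup d j" for j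
  proof (cases "j \<in> {1..r}")
    case True
    then have "wt \<omega> c (co j) = wt \<omega> d (co j)" using eq co by blast
    then show ?thesis
      unfolding wt_coroot[OF \<omega> c True] wt_coroot[OF \<omega> d True] by simp
  next
    case False
    then have "j \<notin> Poly_Mapping.keys c" "j \<notin> Poly_Mapping.keys d"
      using c d by (auto simp: weight_lattice_def)
    then show ?thesis by (simp add: in_keys_iff)
  qed
  then show "c = d" by (rule poly_mapping_eqI)
qed simp

lemma wt_linear:
  assumes h: "cvec.subspace h" and \<omega>: "fundamental_weights h r co \<omega>"
    and c: "c \<in> weight_lattice r"
  shows "x \<in> h \<Longrightarrow> y \<in> h \<Longrightarrow> wt \<omega> c (x + y) = wt \<omega> c x + wt \<omega> c y"
    and "x \<in> h \<Longrightarrow> wt \<omega> c (a *c x) = a * wt \<omega> c x"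
    and "wt \<omega> c 0 = 0"
proof -
  have *: "\<omega> i \<in> dual_of h" if "i \<in> Poly_Mapping.keys c" for i
    using \<omega> c that by (auto simp: weight_lattice_def fundamental_weights_def)
  show "wt \<omega> c (x + y) = wt \<omega> c x + wt \<omega> c y" if "x \<in> h" "y \<in> h" for x y
    unfolding wt_def sum.distrib[symmetric]
    by (intro sum.cong refl) (use * that in \<open>auto simp: dual_of_def algebra_simps\<close>)
  show scale: "wt \<omega> c (a *c x) = a * wt \<omega> c x" if "x \<in> h" for x a
    unfolding wt_def sum_distrib_left
    by (intro sum.cong refl) (use * that in \<open>auto simp: dual_of_def algebra_simps\<close>)
  show "wt \<omega> c 0 = 0"
    using scale[of 0 0] cvec.subspace_0[OF h] by simp
qed

text \<open>The coroots are dual to the fundamental weights, hence independent, and there are as many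
  of them as the dimension of \<open>h\<close>.\<close>

lemma coroots_span:
  fixes h :: "'g::complex_vector set"
  assumes fd: "finite_dimensional (UNIV :: 'g set)" and h: "cvec.subspace h" and r: "r = cvec.dim h"
    and \<omega>: "fundamental_weights h r co \<omega>" and co: "\<And>j. j \<in> {1..r} \<Longrightarrow> co j \<in> h"
  shows "h \<subseteq> cvec.span (co ` {1..r})"
proof -
  have inj: "inj_on co {1..r}"
  proof (rule inj_onI)
    fix i j assume ij: "i \<in> {1..r}" "j \<in> {1..r}" "co i = co j"
    then have "\<omega> i (co j) = 1" using \<omega> unfolding fundamental_weights_def by metis
    then show "i = j"
      using \<omega> ij unfolding fundamental_weights_def by (metis zero_neq_one)
  qed
  have \<omega>sum: "\<omega> i (\<Sum>j\<in>J. a j *c co j) = (\<Sum>j\<in>J. a j * \<omega> i (co j))"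
    if "finite J" "J \<subseteq> {1..r}" "i \<in> {1..r}" for a i J
    using that
  proof (induction J)
    case empty
    have "\<omega> i (0 *c 0) = 0 * \<omega> i 0"
      using empty \<omega> cvec.subspace_0[OF h] unfolding fundamental_weights_def dual_of_def by blast
    then show ?case by simp
  next
    case (insert k J)
    have "a k *c co k \<in> h" "(\<Sum>j\<in>J. a j *c co j) \<in> h"
      using insert.prems co h by (auto intro!: cvec.subspace_scale cvec.subspace_sum)
    moreover have "\<omega> i \<in> dual_of h"
      using insert.prems \<omega> by (simp add: fundamental_weights_def)
    ultimately show ?case
      using insert co by (auto simp: dual_of_def)
  qed
  have ind: "cvec.independent (co ` {1..r})"
  proof (rule cvec.independent_if_scalars_zero)
    fix u x assume sum: "(\<Sum>x\<in>co ` {1..r}. u x *c x) = 0" and x: "x \<in> co ` {1..r}"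
    then obtain i where i: "i \<in> {1..r}" "x = co i" by auto
    have "(\<Sum>j\<in>{1..r}. u (co j) *c co j) = 0"
      using sum inj by (simp add: sum.reindex)
    then have "\<omega> i (\<Sum>j\<in>{}. u (co j) *c co j) = \<omega> i (\<Sum>j\<in>{1..r}. u (co j) *c co j)"
      by simp
    then have "0 = (\<Sum>j\<in>{1..r}. u (co j) * \<omega> i (co j))"
      using i by (subst (asm) (1 2) \<omega>sum) auto
    also have "\<dots> = (\<Sum>j\<in>{1..r}. if i = j then u (co j) else 0)"
      using \<omega> i by (intro sum.cong) (auto simp: fundamental_weights_def)
    finally show "u x = 0" using i by simp
  qed simp
  obtain B where B: "B \<subseteq> h" "cvec.independent B" "h \<subseteq> cvec.span B"
    using cvec.maximal_independent_subset by blast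
  obtain C :: "'g set" where C: "finite C" "UNIV \<subseteq> cvec.span C"
    using fd by (auto simp: finite_dimensional_def)
  have finB: "finite B"
    using cvec.independent_span_bound[OF C(1) B(2)] C(2) by blast
  have cardB: "card B = r"
    using cvec.basis_card_eq_dim[OF B(1,3,2)] r by simp
  show ?thesis
  proof
    fix x assume x: "x \<in> h"
    show "x \<in> cvec.span (co ` {1..r})"
    proof (rule ccontr)
      assume nin: "x \<notin> cvec.span (co ` {1..r})"
      then have "cvec.independent (insert x (co ` {1..r}))"
        using ind by (rule cvec.independent_insertI)
      moreover have "insert x (co ` {1..r}) \<subseteq> cvec.span B" using x co B(3) by auto
      ultimately have "card (insert x (co ` {1..r})) \<le> r"
        using cvec.independent_span_bound[OF finB] cardB by blast
      moreover have "x \<notin> co ` {1..r}" using nin by (auto intro: cvec.span_base)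
      ultimately show False using inj by (simp add: card_image)
    qed
  qed
qed

text \<open>It is enough to diagonalise the finitely many commuting operators \<open>\<rho> (co i)\<close>. Their
  eigenvalues are integers because each coroot lies in a copy of \<open>sl\<^sub>2\<close>, namely the one spanned by
  it and the two root vectors whose bracket it is. As the coroots span \<open>h\<close> and are dual to the
  fundamental weights, these integers are the coordinates of a weight by which all of \<open>h\<close> acts.\<close>

lemma weight_basis:
  fixes br :: "'g::complex_vector \<Rightarrow> 'g \<Rightarrow> 'g" and \<rho> :: "'g \<Rightarrow> 'v::complex_vector \<Rightarrow> 'v"
  assumes fd: "finite_dimensional (UNIV :: 'g set)" and lie: "lie_algebra br"
    and cartan: "cartan_subalgebra br h" and r: "r = cvec.dim h"
    and coroot: "\<And>i. i \<in> {1..r} \<Longrightarrow> is_coroot br h (\<alpha> i) (co i)"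
    and \<omega>: "fundamental_weights h r co \<omega>"
    and irr: "irreducible_representation br \<rho>"
    and hw: "highest_weight br h b \<omega> \<rho> lam"
  obtains B c where "finite B" "cvec.independent B" "cvec.span B = UNIV" "B \<noteq> {}"
    "\<And>e. e \<in> B \<Longrightarrow> c e \<in> weight_lattice r"
    "\<And>e. e \<in> B \<Longrightarrow> e \<in> weight_space h UNIV \<rho> (wt \<omega> (c e))"
proof -
  have rep: "representation br \<rho>" using irr by (simp add: irreducible_representation_def)
  then have fdV: "finite_dimensional (UNIV :: 'v set)" by (simp add: representation_def)
  note lin = representationD[OF rep]
  have h: "cvec.subspace h" and abelian: "\<And>x y. x \<in> h \<Longrightarrow> y \<in> h \<Longrightarrow> br x y = 0"
    and diag: "\<And>t. t \<in> h \<Longrightarrow> diagonalizable (br t)"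
    using cartan by (auto simp: cartan_subalgebra_def)
  have co: "co j \<in> h" if "j \<in> {1..r}" for j using coroot[OF that] by (simp add: is_coroot_def)
  have span_co: "h \<subseteq> cvec.span (co ` {1..r})" by (rule coroots_span[OF fd h r \<omega> co])
  obtain v0 where v0: "v0 \<noteq> 0" "\<And>t. t \<in> h \<Longrightarrow> \<rho> t v0 = wt \<omega> lam t *c v0"
    using hw unfolding highest_weight_def weight_space_def by blast
  let ?E = "{x. \<forall>t\<in>co ` {1..r}. \<exists>a. \<rho> t x = a *c x}"
  have E: "cvec.span ?E = UNIV"
  proof (rule simultaneous_eigenvectors_span)
    show "diagonalizable (\<rho> t)" if "t \<in> co ` {1..r}" for t
    proof -
      have "t \<in> h" using that co by blast
      then show ?thesis
        using irreducible_representation_diagonalizable[OF irr diag v0(1) v0(2)] by blast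
    qed
    show "\<rho> s (\<rho> t x) = \<rho> t (\<rho> s x)" if "s \<in> co ` {1..r}" "t \<in> co ` {1..r}" for s t x
    proof -
      interpret x: Vector_Spaces.linear scaleC scaleC "\<lambda>t. \<rho> t x" by (rule lin)
      have "\<rho> (br s t) x = 0" using that co abelian by (auto simp: x.zero)
      then show ?thesis by (simp add: lin(3))
    qed
  qed (simp_all add: lin)
  obtain B where B: "B \<subseteq> ?E" "cvec.independent B" "?E \<subseteq> cvec.span B"
    using cvec.maximal_independent_subset by blast
  have spanB: "cvec.span B = UNIV"
    using cvec.span_minimal[OF B(3) cvec.subspace_span] E by blast
  obtain C :: "'v set" where C: "finite C" "UNIV \<subseteq> cvec.span C"
    using fdV by (auto simp: finite_dimensional_def)
  have finB: "finite B"
    using cvec.independent_span_bound[OF C(1) B(2)] C(2) by blast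
  have "\<exists>c. c \<in> weight_lattice r \<and> e \<in> weight_space h UNIV \<rho> (wt \<omega> c)" if e: "e \<in> B" for e
  proof -
    have e0: "e \<noteq> 0" using e B(2) cvec.dependent_zero by blast
    have "\<exists>n::int. \<rho> (co i) e = of_int n *c e" if i: "i \<in> {1..r}" for i
    proof -
      obtain a where a: "\<rho> (co i) e = a *c e" using B(1) e i by blast
      obtain x y where x: "x \<in> root_space br h (\<alpha> i)" and y: "y \<in> root_space br h (\<lambda>s. - \<alpha> i s)"
        and xy: "co i = br x y" and two: "\<alpha> i (co i) = 2"
        using coroot[OF i] unfolding is_coroot_def by blast
      have brx: "br (co i) x = 2 *c x" and bry: "br (co i) y = - (2 *c y)"
        using x y two co[OF i] by (auto simp: weight_space_def)
      have "a \<in> \<int>"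
      \<comment> \<open>The triple \<open>co i\<close>, \<open>x\<close>, \<open>y\<close> satisfies the relations of \<open>sl\<^sub>2\<close> because
        \<open>\<alpha> i (co i) = 2\<close>.\<close>
      proof (rule sl2_eigenvalue_integral[OF fdV, of "\<rho> (co i)" "\<rho> x" "\<rho> y" e])
        fix v
        interpret v: Vector_Spaces.linear scaleC scaleC "\<lambda>t. \<rho> t v" by (rule lin)
        show "\<rho> (co i) (\<rho> x v) = \<rho> x (\<rho> (co i) v) + 2 *c \<rho> x v"
          using lin(3)[of "co i" x v] by (simp add: brx v.scale algebra_simps)
        show "\<rho> (co i) (\<rho> y v) = \<rho> y (\<rho> (co i) v) - 2 *c \<rho> y v"
          using lin(3)[of "co i" y v] by (simp add: bry v.neg v.scale algebra_simps)
        show "\<rho> x (\<rho> y v) = \<rho> y (\<rho> x v) + \<rho> (co i) v"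
          using lin(3)[of x y v] by (simp add: xy algebra_simps)
      qed (use lin e0 a in auto)
      then show ?thesis using a by (auto elim: Ints_cases)
    qed
    then obtain n :: "nat \<Rightarrow> int" where n: "\<And>i. i \<in> {1..r} \<Longrightarrow> \<rho> (co i) e = of_int (n i) *c e"
      by metis
    define c :: weight where "c = (\<Sum>i\<in>{1..r}. Poly_Mapping.single i (n i))"
    have look: "Poly_Mapping.lookup c i = (if i \<in> {1..r} then n i else 0)" for i
      by (simp add: c_def lookup_sum lookup_single when_def)
    then have c: "c \<in> weight_lattice r"
      by (auto simp: weight_lattice_def in_keys_iff split: if_splits)
    interpret e: Vector_Spaces.linear scaleC scaleC "\<lambda>t. \<rho> t e" by (rule lin)
    have "t \<in> h \<and> \<rho> t e = wt \<omega> c t *c e" if "t \<in> cvec.span (co ` {1..r})" for t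
      using that
    proof (induction rule: cvec.span_induct_alt)
      case base
      show ?case using cvec.subspace_0[OF h] by (simp add: e.zero wt_linear(3)[OF h \<omega> c])
    next
      case (step a x y)
      then obtain i where i: "i \<in> {1..r}" "x = co i" by blast
      have "\<rho> x e = wt \<omega> c x *c e"
        using n[OF i(1)] wt_coroot[OF \<omega> c i(1)] look i by simp
      moreover have "x \<in> h" "a *c x \<in> h" using i co h by (auto intro: cvec.subspace_scale)
      ultimately show ?case
        using step wt_linear[OF h \<omega> c]
        by (auto simp: e.add e.scale cvec.scale_left_distrib intro: cvec.subspace_add[OF h])
    qed
    then show ?thesis using c span_co by (auto simp: weight_space_def)
  qed
  then obtain c where "\<And>e. e \<in> B \<Longrightarrow> c e \<in> weight_lattice r \<and> e \<in> weight_space h UNIV \<rho> (wt \<omega> (c e))"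
    by metis
  moreover have "B \<noteq> {}" using spanB v0(1) by auto
  ultimately show thesis using that finB B(2) spanB by blast
qed

text \<open>Comparison of coefficients shows that a vector in the span of independent weight vectors has
  weight \<open>f\<close> only if the basis vectors that occur in it have weight \<open>f\<close>.\<close>

lemma dim_weight_space_eq_card:
  assumes I: "finite I" "inj_on e I" "cvec.independent (e ` I)"
    and lin: "\<And>t. t \<in> h \<Longrightarrow> clinear (\<sigma> t)"
    and e: "\<And>i t. i \<in> I \<Longrightarrow> t \<in> h \<Longrightarrow> \<sigma> t (e i) = w i t *c e i"
  shows "cvec.dim (weight_space h (cvec.span (e ` I)) \<sigma> f) = card {i\<in>I. \<forall>t\<in>h. w i t = f t}"
proof -
  let ?J = "{i\<in>I. \<forall>t\<in>h. w i t = f t}"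
  have "weight_space h (cvec.span (e ` I)) \<sigma> f = cvec.span (e ` ?J)"
  proof
    show "weight_space h (cvec.span (e ` I)) \<sigma> f \<subseteq> cvec.span (e ` ?J)"
    proof
      fix x assume x: "x \<in> weight_space h (cvec.span (e ` I)) \<sigma> f"
      then have "x \<in> range (\<lambda>u. \<Sum>v\<in>e ` I. u v *c v)"
        using I(1) by (simp add: weight_space_def cvec.span_finite)
      then obtain u where "x = (\<Sum>v\<in>e ` I. u v *c v)" by blast
      then have xu: "x = (\<Sum>i\<in>I. u (e i) *c e i)" using I(2) by (simp add: sum.reindex)
      have u0: "u (e i) = 0" if i: "i \<in> I" "i \<notin> ?J" for i
      proof -
        obtain t where t: "t \<in> h" "w i t \<noteq> f t" using i by blast
        interpret t: Vector_Spaces.linear scaleC scaleC "\<sigma> t" using lin t by simp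
        have "(\<Sum>i\<in>I. (u (e i) * w i t) *c e i) = \<sigma> t x"
          unfolding xu t.sum using e t by (intro sum.cong) (auto simp: t.scale)
        also have "\<dots> = f t *c x" using x t by (simp add: weight_space_def)
        also have "\<dots> = (\<Sum>i\<in>I. (u (e i) * f t) *c e i)"
          unfolding xu cvec.scale_sum_right by (simp add: mult.commute)
        finally have "(\<Sum>i\<in>I. (u (e i) * (w i t - f t)) *c e i) = 0"
          by (simp add: right_diff_distrib cvec.scale_left_diff_distrib sum_subtractf)
        moreover define g where "g v = u v * (w (the_inv_into I e v) t - f t)" for v
        ultimately have "(\<Sum>v\<in>e ` I. g v *c v) = 0"
          using I(2) by (simp add: sum.reindex the_inv_into_f_f)
        then have "g (e i) = 0"
          using I(1,3) i(1) by (auto simp: cvec.dependent_finite)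
        then show ?thesis using t i(1) I(2) by (simp add: g_def the_inv_into_f_f)
      qed
      have "x = (\<Sum>i\<in>?J. u (e i) *c e i)"
        unfolding xu using I(1) u0 by (intro sum.mono_neutral_right) auto
      also have "\<dots> \<in> cvec.span (e ` ?J)"
        by (intro cvec.span_sum cvec.span_scale cvec.span_base) auto
      finally show "x \<in> cvec.span (e ` ?J)" .
    qed
    show "cvec.span (e ` ?J) \<subseteq> weight_space h (cvec.span (e ` I)) \<sigma> f"
    proof
      fix x assume x: "x \<in> cvec.span (e ` ?J)"
      then have "\<sigma> t x = f t *c x" if t: "t \<in> h" for t
      proof (induction rule: cvec.span_induct_alt)
        interpret t: Vector_Spaces.linear scaleC scaleC "\<sigma> t" using lin t by simp
        case base
        show ?case by (simp add: t.zero)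
      next
        interpret t: Vector_Spaces.linear scaleC scaleC "\<sigma> t" using lin t by simp
        case (step c x y)
        then show ?case using e t
          by (auto simp: t.add t.scale cvec.scale_right_distrib mult.commute)
      qed
      moreover have "x \<in> cvec.span (e ` I)"
        using x cvec.span_mono[of "e ` ?J" "e ` I"] by blast
      ultimately show "x \<in> weight_space h (cvec.span (e ` I)) \<sigma> f"
        by (simp add: weight_space_def)
    qed
  qed
  moreover have "cvec.independent (e ` ?J)"
    by (rule cvec.independent_mono[OF I(3)]) auto
  moreover have "inj_on e ?J" using I(2) by (rule inj_on_subset) auto
  ultimately show ?thesis
    by (simp add: cvec.dim_eq_card_independent card_image)
qed


section \<open>Monomial bases of symmetric powers\<close>

lemma sym_prod_multilinear:
  "sym_prod (add_mset (a *c u + v) M) = a *c sym_prod (add_mset u M) + sym_prod (add_mset v M)"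
proof transfer
  fix a and u v :: 'a and M
  have "free_prod (add_mset (a *c u + v) M) - (a *c free_prod (add_mset u M) + free_prod (add_mset v M))
      \<in> multilin_rels"
    unfolding multilin_rels_def by (auto simp: diff_diff_eq)
  then show "sym_eq (free_prod (add_mset (a *c u + v) M))
      (a *c free_prod (add_mset u M) + free_prod (add_mset v M))"
    unfolding sym_eq_def by (rule cvec.span_base)
qed

lemma sym_prod_zero: "sym_prod (add_mset 0 M) = 0"
  using sym_prod_multilinear[of "-1" 0 0 M] by simp

lemma sym_prod_scale: "sym_prod (add_mset (a *c u) M) = a *c sym_prod (add_mset u M)"
  using sym_prod_multilinear[of a u 0 M] by (simp add: sym_prod_zero)

text \<open>These multisets are the exponents of the monomials of degree \<open>N\<close> in the variables \<open>B\<close>.\<close>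

definition multisets_over :: "'a set \<Rightarrow> nat \<Rightarrow> 'a multiset set" where
  "multisets_over B N = {M. set_mset M \<subseteq> B \<and> size M = N}"

lemma finite_multisets_over: "finite B \<Longrightarrow> finite (multisets_over B N)"
proof (induction N)
  case 0
  then show ?case by (simp add: multisets_over_def)
next
  case (Suc N)
  have "multisets_over B (Suc N) \<subseteq> (\<lambda>(x, M). add_mset x M) ` (B \<times> multisets_over B N)"
  proof
    fix M assume "M \<in> multisets_over B (Suc N)"
    then have M: "set_mset M \<subseteq> B" "size M = Suc N" by (auto simp: multisets_over_def)
    then obtain x M' where "M = add_mset x M'" by (meson size_eq_Suc_imp_eq_union)
    then show "M \<in> (\<lambda>(x, M). add_mset x M) ` (B \<times> multisets_over B N)"
      using M by (auto simp: multisets_over_def)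
  qed
  then show ?case using Suc by (auto intro: finite_subset)
qed

text \<open>The factors outside the basis are expanded one at a time; the multiset \<open>K\<close> collects
  the basis vectors already produced.\<close>

lemma sym_prod_in_span:
  assumes B: "cvec.span B = UNIV" and K: "set_mset K \<subseteq> B"
  shows "sym_prod (M + K) \<in> cvec.span (sym_prod ` multisets_over B (size M + size K))"
  using K
proof (induction M arbitrary: K)
  case empty
  then show ?case by (auto simp: multisets_over_def intro: cvec.span_base)
next
  case (add u M)
  have "u \<in> cvec.span B" using B by simp
  then show ?case
  proof (induction rule: cvec.span_induct_alt)
    case base
    show ?case by (simp add: sym_prod_zero cvec.span_zero)
  next
    case (step c x y)
    have "sym_prod (M + add_mset x K) \<in> cvec.span (sym_prod ` multisets_over B (size M + size (add_mset x K)))"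
      using add.prems step by (intro add.IH) auto
    then show ?case
      using step by (simp add: sym_prod_multilinear cvec.span_add cvec.span_scale)
  qed
qed

lemma sym_power_eq_span:
  assumes B: "cvec.span B = UNIV"
  shows "sym_power N = cvec.span (sym_prod ` multisets_over B N)"
proof
  have "{sym_prod M | M. size M = N} \<subseteq> cvec.span (sym_prod ` multisets_over B N)"
    using sym_prod_in_span[OF B, of "{#}"] by auto
  then show "sym_power N \<subseteq> cvec.span (sym_prod ` multisets_over B N)"
    unfolding sym_power_def by (rule cvec.span_minimal) (rule cvec.subspace_span)
  show "cvec.span (sym_prod ` multisets_over B N) \<subseteq> sym_power N"
    unfolding sym_power_def by (rule cvec.span_mono) (auto simp: multisets_over_def)
qed

text \<open>The free vector space on multisets is the monoid algebra of the free commutative monoid, that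
  is, a polynomial ring. A vector becomes the linear form of its coordinates, and a formal product
  of vectors becomes the product of their linear forms.\<close>

definition linear_form :: "'v::complex_vector set \<Rightarrow> 'v \<Rightarrow> 'v free_sym" where
  "linear_form B v = (\<Sum>e\<in>B. Poly_Mapping.single {#e#} (cvec.representation B v e))"

definition polynomial_of :: "'v::complex_vector set \<Rightarrow> 'v free_sym \<Rightarrow> 'v free_sym" where
  "polynomial_of B p =
     (\<Sum>M\<in>Poly_Mapping.keys p. Poly_Mapping.lookup p M *c (\<Prod>v\<in>#M. linear_form B v))"

lemma polynomial_of_superset:
  assumes "finite S" "Poly_Mapping.keys p \<subseteq> S"
  shows "polynomial_of B p = (\<Sum>M\<in>S. Poly_Mapping.lookup p M *c (\<Prod>v\<in>#M. linear_form B v))"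
  unfolding polynomial_of_def using assms
  by (intro sum.mono_neutral_left) (auto simp: in_keys_iff)

lemma clinear_polynomial_of: "clinear (polynomial_of B)"
proof unfold_locales
  fix p q :: "'a free_sym" and a :: complex
  let ?P = "\<lambda>M. \<Prod>v\<in>#M. linear_form B v"
  let ?S = "Poly_Mapping.keys p \<union> Poly_Mapping.keys q \<union> Poly_Mapping.keys (p + q)"
  have "polynomial_of B (p + q) = (\<Sum>M\<in>?S. Poly_Mapping.lookup (p + q) M *c ?P M)"
    by (rule polynomial_of_superset) auto
  also have "\<dots> = (\<Sum>M\<in>?S. Poly_Mapping.lookup p M *c ?P M) + (\<Sum>M\<in>?S. Poly_Mapping.lookup q M *c ?P M)"
    by (simp add: lookup_add cvec.scale_left_distrib sum.distrib)
  also have "\<dots> = polynomial_of B p + polynomial_of B q"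
    by (subst (1 2) polynomial_of_superset[of ?S, symmetric]) auto
  finally show "polynomial_of B (p + q) = polynomial_of B p + polynomial_of B q" .
  have "Poly_Mapping.keys (a *c p) \<subseteq> Poly_Mapping.keys p"
    by (auto simp: in_keys_iff)
  then have "polynomial_of B (a *c p) = (\<Sum>M\<in>Poly_Mapping.keys p. Poly_Mapping.lookup (a *c p) M *c ?P M)"
    by (intro polynomial_of_superset) auto
  also have "\<dots> = a *c polynomial_of B p"
    by (simp add: polynomial_of_def cvec.scale_sum_right scaleC_complex_def)
  finally show "polynomial_of B (a *c p) = a *c polynomial_of B p" .
qed

lemma polynomial_of_free_prod: "polynomial_of B (free_prod M) = (\<Prod>v\<in>#M. linear_form B v)"
  by (simp add: polynomial_of_def)

lemma single_zero_mult_eq_scaleC: "Poly_Mapping.single 0 a * p = a *c (p :: 'v free_sym)"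
proof (rule poly_mapping_eqI)
  fix k
  have "Poly_Mapping.lookup (Poly_Mapping.single 0 a * p) k = a * Poly_Mapping.lookup p k"
    unfolding mult_map_scale_conv_mult[symmetric] by (simp add: Poly_Mapping.map.rep_eq when_def)
  then show "Poly_Mapping.lookup (Poly_Mapping.single 0 a * p) k = Poly_Mapping.lookup (a *c p) k"
    by (simp add: scaleC_complex_def)
qed

lemma linear_form_multilinear:
  assumes B: "cvec.independent B" "cvec.span B = UNIV"
  shows "linear_form B (a *c u + v) = a *c linear_form B u + linear_form B v"
proof -
  have "linear_form B (a *c u + v) = (\<Sum>e\<in>B. Poly_Mapping.single {#e#}
      (a * cvec.representation B u e + cvec.representation B v e))"
    using B by (simp add: linear_form_def cvec.representation_add cvec.representation_scale)
  also have "\<dots> = (\<Sum>e\<in>B. a *c Poly_Mapping.single {#e#} (cvec.representation B u e))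
      + (\<Sum>e\<in>B. Poly_Mapping.single {#e#} (cvec.representation B v e))"
    by (simp add: single_add sum.distrib single_zero_mult_eq_scaleC[symmetric] mult_single)
  finally show ?thesis by (simp add: linear_form_def cvec.scale_sum_right)
qed

lemma linear_form_basis:
  assumes B: "finite B" "cvec.independent B" and e: "e \<in> B"
  shows "linear_form B e = Poly_Mapping.single {#e#} 1"
proof -
  have "linear_form B e = (\<Sum>x\<in>B. if x = e then Poly_Mapping.single {#e#} 1 else 0)"
    unfolding linear_form_def cvec.representation_basis[OF B(2) e] by (intro sum.cong) auto
  then show ?thesis using B(1) e by simp
qed

lemma prod_linear_form_basis:
  assumes B: "finite B" "cvec.independent B" and M: "set_mset M \<subseteq> B"
  shows "(\<Prod>v\<in>#M. linear_form B v) = free_prod M"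
  using M by (induction M) (auto simp: linear_form_basis[OF B] mult_single)

lemma polynomial_of_rels:
  assumes B: "cvec.independent B" "cvec.span B = UNIV" and p: "p \<in> cvec.span multilin_rels"
  shows "polynomial_of B p = 0"
proof -
  interpret P: Vector_Spaces.linear scaleC scaleC "polynomial_of B" by (rule clinear_polynomial_of)
  have "polynomial_of B q = 0" if q_rel: "q \<in> multilin_rels" for q
  proof -
    obtain a u v M where q: "q = free_prod (add_mset (a *c u + v) M)
        - a *c free_prod (add_mset u M) - free_prod (add_mset v M)"
      using q_rel by (auto simp: multilin_rels_def)
    show ?thesis
      unfolding q P.diff P.scale polynomial_of_free_prod image_mset_add_mset prod_mset.add_mset
        linear_form_multilinear[OF B]
      by (simp add: single_zero_mult_eq_scaleC[symmetric] algebra_simps)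
  qed
  then show ?thesis using P.eq_0_on_span[OF _ p] by blast
qed

text \<open>A linear relation between monomials in the symmetric power lifts to an element of the span
  of the multilinearity relations; as a polynomial it vanishes, but monomials in the basis
  vectors are independent as polynomials.\<close>

lemma sym_prod_independent:
  assumes B: "finite B" "cvec.independent B" "cvec.span B = UNIV"
    and S: "finite S" "\<And>M. M \<in> S \<Longrightarrow> set_mset M \<subseteq> B"
    and sum: "(\<Sum>M\<in>S. u M *c sym_prod M) = 0" and M: "M \<in> S"
  shows "u M = 0"
proof -
  define p where "p = (\<Sum>M\<in>S. u M *c free_prod M)"
  have abs: "abs_symalg (\<Sum>M\<in>T. u M *c free_prod M) = (\<Sum>M\<in>T. u M *c sym_prod M)"
    if "finite T" for T
    using that
    by (induction T)
      (simp_all add: zero_symalg_def[symmetric] plus_symalg.abs_eq[symmetric]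
        scaleC_symalg.abs_eq[symmetric] sym_prod_def)
  have "abs_symalg p = abs_symalg 0"
    unfolding p_def abs[OF S(1)] sum by (simp add: zero_symalg_def)
  then have "sym_eq p 0" by (simp add: symalg.abs_eq_iff)
  then have "polynomial_of B p = 0"
    by (intro polynomial_of_rels[OF B(2,3)]) (simp add: sym_eq_def)
  moreover have "polynomial_of B p = p"
  proof -
    interpret P: Vector_Spaces.linear scaleC scaleC "polynomial_of B" by (rule clinear_polynomial_of)
    show ?thesis
      unfolding p_def P.sum P.scale polynomial_of_free_prod
      using S(2) by (intro sum.cong refl) (simp add: prod_linear_form_basis[OF B(1,2)])
  qed
  ultimately have "Poly_Mapping.lookup p M = 0" by simp
  moreover have "Poly_Mapping.lookup p M = (\<Sum>L\<in>S. if L = M then u L else 0)"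
    unfolding p_def lookup_sum
    by (intro sum.cong refl) (simp add: lookup_single scaleC_complex_def)
  ultimately show ?thesis using S(1) M by simp
qed

lemma sym_prod_inj_on:
  assumes B: "finite B" "cvec.independent B" "cvec.span B = UNIV"
  shows "inj_on sym_prod (multisets_over B N)"
proof (rule inj_onI, rule ccontr)
  fix M L assume *: "M \<in> multisets_over B N" "L \<in> multisets_over B N" "sym_prod M = sym_prod L" "M \<noteq> L"
  then have "(\<Sum>K\<in>{M, L}. (if K = M then 1 else - 1) *c sym_prod K) = 0" by simp
  then have "(if M = M then 1 else - 1 :: complex) = 0"
    by (rule sym_prod_independent[OF B, rotated 2]) (use * in \<open>auto simp: multisets_over_def\<close>)
  then show False by simp
qed

lemma sym_prod_image_independent:
  assumes B: "finite B" "cvec.independent B" "cvec.span B = UNIV"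
  shows "cvec.independent (sym_prod ` multisets_over B N)"
proof (rule cvec.independent_if_scalars_zero)
  fix u x
  assume "(\<Sum>x\<in>sym_prod ` multisets_over B N. u x *c x) = 0" and x: "x \<in> sym_prod ` multisets_over B N"
  then have "(\<Sum>M\<in>multisets_over B N. u (sym_prod M) *c sym_prod M) = 0"
    using sym_prod_inj_on[OF B] by (simp add: sum.reindex)
  then have "u (sym_prod M) = 0" if "M \<in> multisets_over B N" for M
    by (rule sym_prod_independent[OF B finite_multisets_over[OF B(1)] _ _ that, rotated])
      (simp_all add: multisets_over_def)
  then show "u x = 0" using x by blast
qed (simp add: finite_multisets_over B)

lemma clinear_sym_action: "clinear (sym_action f)"
proof unfold_locales
  have D: "free_action f (p + q) = free_action f p + free_action f q"
    "free_action f (a *c p) = a *c free_action f p" for f :: "'a \<Rightarrow> 'a" and p q a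
  proof -
    interpret D: Vector_Spaces.linear scaleC scaleC "free_action f" by (rule clinear_free_action)
    show "free_action f (p + q) = free_action f p + free_action f q"
      "free_action f (a *c p) = a *c free_action f p" by (rule D.add D.scale)+
  qed
  show "sym_action f (x + y) = sym_action f x + sym_action f y" for x y
    by transfer (simp add: D sym_eq_def cvec.span_zero)
  show "sym_action f (a *c x) = a *c sym_action f x" for a x
    by transfer (simp add: D sym_eq_def cvec.span_zero)
qed

lemma sym_action_sym_prod:
  assumes "clinear f"
  shows "sym_action f (sym_prod M) = (\<Sum>v\<in>#M. sym_prod (add_mset (f v) (M - {#v#})))"
proof -
  have "abs_symalg (\<Sum>v\<in>#L. free_prod (add_mset (f v) (M - {#v#})))
      = (\<Sum>v\<in>#L. sym_prod (add_mset (f v) (M - {#v#})))" for L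
    by (induction L)
      (simp_all add: zero_symalg_def[symmetric] plus_symalg.abs_eq[symmetric] sym_prod_def)
  then show ?thesis
    using assms by (simp add: sym_prod_def sym_action.abs_eq free_action_free_prod leibniz_def)
qed

lemma sym_action_eigenvectors:
  assumes f: "clinear f" and M: "\<And>v. v \<in># M \<Longrightarrow> f v = a v *c v"
  shows "sym_action f (sym_prod M) = (\<Sum>v\<in>#M. a v) *c sym_prod M"
proof -
  have "(\<Sum>v\<in>#L. sym_prod (add_mset (f v) (M - {#v#}))) = (\<Sum>v\<in>#L. a v) *c sym_prod M"
    if "set_mset L \<subseteq> set_mset M" for L
    using that M
    by (induction L) (auto simp: sym_prod_scale cvec.scale_left_distrib insert_DiffM)
  then show ?thesis by (simp add: sym_action_sym_prod[OF f])
qed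


section \<open>Taylor coefficients of rational functions in one variable\<close>

lemma fract_deriv_Fract:
  "b \<noteq> 0 \<Longrightarrow> fract_deriv (Fract a b) = Fract (pderiv a * b - a * pderiv b) (b * b)"
  by transfer simp

lemma fract_deriv_Fract_1: "fract_deriv (Fract p 1) = Fract (pderiv p) 1"
  by (simp add: fract_deriv_Fract)

lemma fract_deriv_add: "fract_deriv (f + g) = fract_deriv f + fract_deriv g"
  by (cases f; cases g)
    (simp add: fract_deriv_Fract eq_fract pderiv_add pderiv_mult algebra_simps)

lemma fract_deriv_mult: "fract_deriv (f * g) = fract_deriv f * g + f * fract_deriv g"
  by (cases f; cases g)
    (simp add: fract_deriv_Fract eq_fract pderiv_add pderiv_mult algebra_simps)

lemma fract_deriv_0: "fract_deriv 0 = 0"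
  by (simp add: Zero_fract_def fract_deriv_Fract_1)

lemma fract_deriv_iterate_0: "(fract_deriv ^^ l) 0 = 0"
  by (induction l) (simp_all add: fract_deriv_0)

lemma fract_deriv_iterate_add:
  "(fract_deriv ^^ l) (f + g) = (fract_deriv ^^ l) f + (fract_deriv ^^ l) g"
  by (induction l) (simp_all add: fract_deriv_add)

lemma fract_deriv_iterate_sum:
  "(fract_deriv ^^ l) (\<Sum>i\<in>I. f i) = (\<Sum>i\<in>I. (fract_deriv ^^ l) (f i))"
  by (induction I rule: infinite_finite_induct)
    (simp_all add: fract_deriv_iterate_0 fract_deriv_iterate_add)

lemma Fract_1_power: "Fract a 1 ^ n = Fract (a ^ n) 1"
  by (induction n) (simp_all add: One_fract_def)

lemma Fract_1_sum: "(\<Sum>i\<in>I. Fract (f i) 1) = Fract (\<Sum>i\<in>I. f i) 1"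
  by (induction I rule: infinite_finite_induct) (simp_all add: Zero_fract_def)

lemma Fract_1_prod: "(\<Prod>i\<in>I. Fract (f i) 1) = Fract (\<Prod>i\<in>I. f i) 1"
  by (induction I rule: infinite_finite_induct) (simp_all add: One_fract_def)

text \<open>The coefficients of a partial fraction decomposition lie in every subfield that contains the
  poles and the coefficients of the given fraction. This is how they are seen to be rational in
  \<open>q\<^sub>1, \<dots>, q\<^sub>r\<close>, and not in further variables.\<close>

definition subfield :: "'a::field set \<Rightarrow> bool" where
  "subfield F \<longleftrightarrow> 1 \<in> F \<and> (\<forall>x\<in>F. \<forall>y\<in>F. x - y \<in> F \<and> x * y \<in> F) \<and> (\<forall>x\<in>F. inverse x \<in> F)"

context
  fixes F :: "'a::field set"
  assumes F: "subfield F"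
begin

lemma subfield_1: "1 \<in> F"
  and subfield_diff: "x \<in> F \<Longrightarrow> y \<in> F \<Longrightarrow> x - y \<in> F"
  and subfield_mult: "x \<in> F \<Longrightarrow> y \<in> F \<Longrightarrow> x * y \<in> F"
  and subfield_inverse: "x \<in> F \<Longrightarrow> inverse x \<in> F"
  using F by (auto simp: subfield_def)

lemma subfield_0: "0 \<in> F"
  using subfield_diff[OF subfield_1 subfield_1] by simp

lemma subfield_minus: "x \<in> F \<Longrightarrow> - x \<in> F"
  using subfield_diff[OF subfield_0] by simp

lemma subfield_add: "x \<in> F \<Longrightarrow> y \<in> F \<Longrightarrow> x + y \<in> F"
  using subfield_diff[of x "- y"] subfield_minus by simp

lemma subfield_divide: "x \<in> F \<Longrightarrow> y \<in> F \<Longrightarrow> x / y \<in> F"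
  unfolding divide_inverse by (intro subfield_mult subfield_inverse)

lemma subfield_sum: "(\<And>i. i \<in> I \<Longrightarrow> f i \<in> F) \<Longrightarrow> (\<Sum>i\<in>I. f i) \<in> F"
  by (induction I rule: infinite_finite_induct) (auto intro: subfield_0 subfield_add)

lemma subfield_of_nat: "of_nat n \<in> F"
  by (induction n) (auto intro: subfield_0 subfield_1 subfield_add)

lemma subfield_power: "x \<in> F \<Longrightarrow> x ^ n \<in> F"
  by (induction n) (auto intro: subfield_1 subfield_mult)

end

definition coeffs_in :: "'a::zero set \<Rightarrow> 'a poly \<Rightarrow> bool" where
  "coeffs_in F p \<longleftrightarrow> (\<forall>i. coeff p i \<in> F)"

lemma coeffs_in_UNIV [simp]: "coeffs_in UNIV p"
  by (simp add: coeffs_in_def)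

text \<open>The local ring at \<open>z\<close>, with coefficients in \<open>F\<close>.\<close>

definition regular_at :: "'a::field set \<Rightarrow> 'a \<Rightarrow> 'a poly fract set" where
  "regular_at F z = {Fract a b | a b. poly b z \<noteq> 0 \<and> coeffs_in F a \<and> coeffs_in F b}"

lemma regular_atI:
  "poly b z \<noteq> 0 \<Longrightarrow> coeffs_in F a \<Longrightarrow> coeffs_in F b \<Longrightarrow> Fract a b \<in> regular_at F z"
  by (auto simp: regular_at_def)

lemma regular_atE:
  assumes "f \<in> regular_at F z"
  obtains a b where "f = Fract a b" "poly b z \<noteq> 0" "b \<noteq> 0" "coeffs_in F a" "coeffs_in F b"
proof -
  obtain a b where "f = Fract a b" "poly b z \<noteq> 0" "coeffs_in F a" "coeffs_in F b"
    using assms unfolding regular_at_def by blast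
  moreover from this have "b \<noteq> 0" by auto
  ultimately show thesis using that by blast
qed

context
  fixes F :: "'a::field set"
  assumes F: "subfield F"
begin

lemma coeffs_mult:
  assumes "coeffs_in F p" "coeffs_in F q"
  shows "coeffs_in F (p * q)"
  using assms by (auto simp: coeffs_in_def coeff_mult intro!: subfield_sum[OF F] subfield_mult[OF F])

lemma coeffs_add:
  assumes "coeffs_in F p" "coeffs_in F q"
  shows "coeffs_in F (p + q)"
  using assms by (auto simp: coeffs_in_def intro!: subfield_add[OF F])

lemma coeffs_diff:
  assumes "coeffs_in F p" "coeffs_in F q"
  shows "coeffs_in F (p - q)"
  using assms by (auto simp: coeffs_in_def intro!: subfield_diff[OF F])

lemma coeffs_pderiv: "coeffs_in F p \<Longrightarrow> coeffs_in F (pderiv p)"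
  by (auto simp: coeffs_in_def coeff_pderiv simp del: of_nat_Suc intro!: subfield_mult[OF F] subfield_of_nat[OF F])

lemma coeffs_pCons: "a \<in> F \<Longrightarrow> coeffs_in F p \<Longrightarrow> coeffs_in F (pCons a p)"
  by (auto simp: coeffs_in_def coeff_pCons split: nat.split)

lemma coeffs_0: "coeffs_in F 0"
  by (auto simp: coeffs_in_def intro: subfield_0[OF F])

lemma coeffs_1: "coeffs_in F 1"
  unfolding one_pCons by (intro coeffs_pCons coeffs_0 subfield_1[OF F])

lemma regular_at_add: "f \<in> regular_at F z \<Longrightarrow> g \<in> regular_at F z \<Longrightarrow> f + g \<in> regular_at F z"
  by (elim regular_atE) (auto intro!: regular_atI coeffs_add coeffs_mult)

lemma regular_at_mult: "f \<in> regular_at F z \<Longrightarrow> g \<in> regular_at F z \<Longrightarrow> f * g \<in> regular_at F z"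
  by (elim regular_atE) (auto intro!: regular_atI coeffs_mult)

lemma regular_at_poly: "coeffs_in F p \<Longrightarrow> Fract p 1 \<in> regular_at F z"
  using coeffs_1 by (auto intro!: regular_atI)

lemma regular_at_1: "1 \<in> regular_at F z"
  unfolding One_fract_def by (intro regular_at_poly coeffs_1)

lemma regular_at_power: "f \<in> regular_at F z \<Longrightarrow> f ^ n \<in> regular_at F z"
  by (induction n) (auto intro: regular_at_1 regular_at_mult)

lemma regular_at_prod: "(\<And>i. i \<in> I \<Longrightarrow> f i \<in> regular_at F z) \<Longrightarrow> (\<Prod>i\<in>I. f i) \<in> regular_at F z"
  by (induction I rule: infinite_finite_induct) (auto intro: regular_at_1 regular_at_mult)

lemma regular_at_deriv: "f \<in> regular_at F z \<Longrightarrow> fract_deriv f \<in> regular_at F z"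
  by (elim regular_atE)
    (auto simp: fract_deriv_Fract intro!: regular_atI coeffs_diff coeffs_mult coeffs_pderiv)

lemma regular_at_deriv_iterate: "f \<in> regular_at F z \<Longrightarrow> (fract_deriv ^^ l) f \<in> regular_at F z"
  by (induction l) (auto intro: regular_at_deriv)

lemma fract_eval_in_subfield:
  assumes "f \<in> regular_at F z" "z \<in> F"
  shows "fract_eval f z \<in> F"
proof -
  have poly: "poly p z \<in> F" if "coeffs_in F p" for p
    unfolding poly_altdef using that \<open>z \<in> F\<close>
    by (auto simp: coeffs_in_def intro!: subfield_sum[OF F] subfield_mult[OF F] subfield_power[OF F])
  show ?thesis
    using assms(1)
    by (elim regular_atE) (auto simp: fract_eval_Fract intro!: subfield_divide[OF F] poly)
qed

lemma fract_eval_add: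
  "f \<in> regular_at F z \<Longrightarrow> g \<in> regular_at F z \<Longrightarrow> fract_eval (f + g) z = fract_eval f z + fract_eval g z"
  by (elim regular_atE) (simp add: fract_eval_Fract field_simps)

lemma fract_eval_mult:
  "f \<in> regular_at F z \<Longrightarrow> g \<in> regular_at F z \<Longrightarrow> fract_eval (f * g) z = fract_eval f z * fract_eval g z"
  by (elim regular_atE) (simp add: fract_eval_Fract)

lemma fract_eval_sum:
  "finite I \<Longrightarrow> (\<And>i. i \<in> I \<Longrightarrow> f i \<in> regular_at F z)
    \<Longrightarrow> (\<Sum>i\<in>I. f i) \<in> regular_at F z \<and> fract_eval (\<Sum>i\<in>I. f i) z = (\<Sum>i\<in>I. fract_eval (f i) z)"
proof (induction I rule: finite_induct)
  case empty
  have "(0 :: 'a poly fract) \<in> regular_at F z"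
    unfolding Zero_fract_def by (intro regular_at_poly coeffs_0)
  moreover have "fract_eval (0 :: 'a poly fract) z = 0"
    unfolding Zero_fract_def by (simp add: fract_eval_Fract)
  ultimately show ?case by simp
next
  case (insert i I)
  then show ?case by (auto simp: fract_eval_add intro: regular_at_add)
qed

end

lemma subfield_UNIV: "subfield UNIV"
  by (simp add: subfield_def)

lemmas regular_rules = regular_at_add[OF subfield_UNIV] regular_at_mult[OF subfield_UNIV]
  regular_at_poly[OF subfield_UNIV] regular_at_power[OF subfield_UNIV]
  regular_at_deriv[OF subfield_UNIV] regular_at_deriv_iterate[OF subfield_UNIV]

text \<open>After subtraction of its value, a function regular at \<open>1 / y\<close> vanishes there, so that
  \<open>1 - y z\<close> can be split off. The constant \<open>c\<close> is that value.\<close>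

lemma regular_expansion_step:
  assumes y: "y \<noteq> 0" and f: "f \<in> regular_at UNIV (inverse y)"
  shows "\<exists>c. \<exists>g\<in>regular_at UNIV (inverse y). f = Fract [:c:] 1 + Fract [:1, - y:] 1 * g"
proof -
  obtain a b where ab: "f = Fract a b" "poly b (inverse y) \<noteq> 0" "b \<noteq> 0"
    using f by (elim regular_atE)
  define c where "c = poly a (inverse y) / poly b (inverse y)"
  have "poly (a - smult c b) (inverse y) = 0" using ab by (simp add: c_def)
  then obtain q where q: "a - smult c b = [:- inverse y, 1:] * q"
    unfolding poly_eq_0_iff_dvd by (rule dvdE)
  define q' where "q' = smult (- inverse y) q"
  have W: "[:1, - y:] = smult (- y) [:- inverse y, 1:]" using y by simp
  have "[:1, - y:] * q' = [:- inverse y, 1:] * q"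
    unfolding W q'_def mult_smult_left mult_smult_right smult_smult using y by simp
  then have "a = smult c b + [:1, - y:] * q'" using q by (metis add.commute diff_add_cancel)
  then have "f = Fract [:c:] 1 + Fract [:1, - y:] 1 * Fract q' b"
    using ab by (simp add: eq_fract algebra_simps)
  moreover have "Fract q' b \<in> regular_at UNIV (inverse y)"
    using ab by (auto intro: regular_atI)
  ultimately show ?thesis by blast
qed

lemma regular_expansion:
  assumes y: "y \<noteq> 0" and f: "f \<in> regular_at UNIV (inverse y)"
  shows "\<exists>c. \<exists>g\<in>regular_at UNIV (inverse y).
    f = (\<Sum>l<n. Fract [:c l:] 1 * Fract [:1, - y:] 1 ^ l) + Fract [:1, - y:] 1 ^ n * g"
proof (induction n)
  case 0
  show ?case using f by auto
next
  case (Suc n)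
  then obtain c g where g: "g \<in> regular_at UNIV (inverse y)"
    "f = (\<Sum>l<n. Fract [:c l:] 1 * Fract [:1, - y:] 1 ^ l) + Fract [:1, - y:] 1 ^ n * g" by blast
  obtain d g' where g': "g' \<in> regular_at UNIV (inverse y)"
    "g = Fract [:d:] 1 + Fract [:1, - y:] 1 * g'"
    using regular_expansion_step[OF y g(1)] by blast
  have "(\<Sum>l<n. Fract [:(c(n := d)) l:] 1 * Fract [:1, - y:] 1 ^ l)
      = (\<Sum>l<n. Fract [:c l:] 1 * Fract [:1, - y:] 1 ^ l)"
    by (intro sum.cong) auto
  then have "f = (\<Sum>l<Suc n. Fract [:(c(n := d)) l:] 1 * Fract [:1, - y:] 1 ^ l)
      + Fract [:1, - y:] 1 ^ Suc n * g'"
    using g(2) g'(2) by (simp add: distrib_left mult_ac add_ac del: mult_fract add_fract)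
  then show ?case using g'(1) by blast
qed

lemma fract_deriv_linear_power:
  fixes y :: "'a::field_char_0"
  shows "fract_deriv (Fract [:c:] 1 * Fract [:1, - y:] 1 ^ Suc k)
    = Fract [:c * of_nat (Suc k) * (- y):] 1 * Fract [:1, - y:] 1 ^ k"
proof -
  have "pderiv ([:c:] * [:1, - y:] ^ Suc k) = [:c * of_nat (Suc k) * (- y):] * [:1, - y:] ^ k"
    by (simp add: pderiv_smult pderiv_power_Suc pderiv_pCons mult_ac del: of_nat_Suc power_Suc)
  then show ?thesis
    unfolding Fract_1_power mult_fract by (simp only: fract_deriv_Fract_1 mult_1)
qed

lemma fract_deriv_iterate_linear_power:
  fixes y :: "'a::field_char_0"
  shows "(fract_deriv ^^ l) (Fract [:c:] 1 * Fract [:1, - y:] 1 ^ l) = Fract [:c * fact l * (- y) ^ l:] 1"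
proof (induction l arbitrary: c)
  case (Suc l)
  show ?case
    unfolding funpow_Suc_right o_apply fract_deriv_linear_power Suc by (simp add: mult_ac)
qed (simp add: One_fract_def)

lemma fract_deriv_iterate_linear_power_low:
  fixes y :: "'a::field_char_0"
  assumes "j < l"
  shows "(fract_deriv ^^ l) (Fract [:c:] 1 * Fract [:1, - y:] 1 ^ j) = 0"
proof -
  obtain i where l: "l = Suc i + j" using assms less_iff_Suc_add by (metis add.commute add_Suc)
  have "fract_deriv (Fract [:d:] 1) = (0 :: 'a poly fract)" for d
    by (simp add: fract_deriv_Fract_1 pderiv_pCons Zero_fract_def)
  then show ?thesis
    unfolding l funpow_add o_apply fract_deriv_iterate_linear_power funpow_Suc_right
    by (simp add: fract_deriv_iterate_0)
qed

text \<open>By the product rule each differentiation lowers the order of vanishing by at most one.\<close>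

lemma fract_deriv_iterate_vanishing:
  fixes y :: "'a::field_char_0"
  assumes g: "g \<in> regular_at UNIV z" and "l \<le> n"
  shows "\<exists>g'\<in>regular_at UNIV z.
    (fract_deriv ^^ l) (Fract [:1, - y:] 1 ^ n * g) = Fract [:1, - y:] 1 ^ (n - l) * g'"
  using \<open>l \<le> n\<close>
proof (induction l)
  case 0
  show ?case using g by auto
next
  case (Suc l)
  let ?W = "Fract [:1, - y:] 1"
  obtain g' where g': "g' \<in> regular_at UNIV z"
    "(fract_deriv ^^ l) (?W ^ n * g) = ?W ^ (n - l) * g'"
    using Suc by auto
  obtain k where k: "n - l = Suc k" "n - Suc l = k" using Suc.prems by (cases "n - l") auto
  have dW: "fract_deriv (?W ^ Suc k) = Fract [:of_nat (Suc k) * (- y):] 1 * ?W ^ k"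
    using fract_deriv_linear_power[of 1 y k] by (simp add: one_pCons[symmetric] One_fract_def[symmetric] del: power_Suc of_nat_Suc)
  have "(fract_deriv ^^ Suc l) (?W ^ n * g) = fract_deriv (?W ^ Suc k * g')"
    by (simp only: funpow.simps o_apply g'(2) k)
  also have "\<dots> = fract_deriv (?W ^ Suc k) * g' + ?W ^ Suc k * fract_deriv g'"
    by (rule fract_deriv_mult)
  also have "\<dots> = ?W ^ (n - Suc l) * (Fract [:of_nat (Suc k) * (- y):] 1 * g' + ?W * fract_deriv g')"
    unfolding dW k unfolding power_Suc by (simp only: distrib_left mult_ac)
  finally have "(fract_deriv ^^ Suc l) (?W ^ n * g)
      = ?W ^ (n - Suc l) * (Fract [:of_nat (Suc k) * (- y):] 1 * g' + ?W * fract_deriv g')" .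
  moreover have "Fract [:of_nat (Suc k) * (- y):] 1 * g' + ?W * fract_deriv g' \<in> regular_at UNIV z"
    by (intro regular_rules g') auto
  ultimately show ?case by blast
qed

text \<open>Only the term of order \<open>l\<close> contributes to the \<open>l\<close>-th derivative at \<open>1 / y\<close>: the lower terms
  are differentiated to zero, and the higher terms and the remainder still vanish at \<open>1 / y\<close>.\<close>

lemma fract_eval_deriv_expansion:
  fixes y :: "'a::field_char_0"
  assumes y: "y \<noteq> 0" and g: "g \<in> regular_at UNIV (inverse y)"
    and f: "f = (\<Sum>l<n. Fract [:c l:] 1 * Fract [:1, - y:] 1 ^ l) + Fract [:1, - y:] 1 ^ n * g"
    and l: "l < n"
  shows "fract_eval ((fract_deriv ^^ l) f) (inverse y) = c l * fact l * (- y) ^ l"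
proof -
  let ?W = "Fract [:1, - y:] 1" and ?R = "regular_at UNIV (inverse y)"
  let ?t = "\<lambda>j. (fract_deriv ^^ l) (Fract [:c j:] 1 * ?W ^ j)"
  have W: "?W \<in> ?R" by (intro regular_rules) auto
  have C: "Fract [:d:] 1 \<in> ?R" for d by (intro regular_rules) auto
  have W0: "fract_eval ?W (inverse y) = 0" using y by (simp add: fract_eval_Fract)
  have van: "fract_eval ((fract_deriv ^^ l) (?W ^ j * h)) (inverse y) = 0" if "l < j" "h \<in> ?R" for j h
  proof -
    obtain g' where g': "g' \<in> ?R" "(fract_deriv ^^ l) (?W ^ j * h) = ?W ^ (j - l) * g'"
      using fract_deriv_iterate_vanishing[OF \<open>h \<in> ?R\<close>, of l j y] \<open>l < j\<close> by auto
    obtain k where k: "j - l = Suc k" using \<open>l < j\<close> by (cases "j - l") auto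
    have "fract_eval (?W * (?W ^ k * g')) (inverse y) = 0"
      using W0 W g'(1)
      by (subst fract_eval_mult[OF subfield_UNIV]) (auto intro!: regular_rules)
    then show ?thesis unfolding g'(2) k power_Suc mult.assoc .
  qed
  have t: "fract_eval (?t j) (inverse y) = (if j = l then c l * fact l * (- y) ^ l else 0)" for j
  proof (cases j l rule: linorder_cases)
    case less
    then show ?thesis
      by (simp add: fract_deriv_iterate_linear_power_low Zero_fract_def fract_eval_Fract del: mult_fract)
  next
    case equal
    then show ?thesis
      by (simp add: fract_deriv_iterate_linear_power fract_eval_Fract del: mult_fract)
  next
    case greater
    then show ?thesis using van[OF greater C, of "c j"] by (simp add: mult.commute del: mult_fract)
  qed
  have tR: "?t j \<in> ?R" for j by (intro regular_rules W C)
  have sumR: "(\<Sum>j<n. ?t j) \<in> ?R \<and> fract_eval (\<Sum>j<n. ?t j) (inverse y) = (\<Sum>j<n. fract_eval (?t j) (inverse y))"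
    by (rule fract_eval_sum[OF subfield_UNIV]) (simp_all add: tR del: mult_fract)
  have "(fract_deriv ^^ l) f = (\<Sum>j<n. ?t j) + (fract_deriv ^^ l) (?W ^ n * g)"
    unfolding f fract_deriv_iterate_add fract_deriv_iterate_sum ..
  moreover have "(fract_deriv ^^ l) (?W ^ n * g) \<in> ?R" by (intro regular_rules W g)
  ultimately have "fract_eval ((fract_deriv ^^ l) f) (inverse y)
      = fract_eval (\<Sum>j<n. ?t j) (inverse y) + fract_eval ((fract_deriv ^^ l) (?W ^ n * g)) (inverse y)"
    using sumR by (simp only: fract_eval_add[OF subfield_UNIV])
  also have "\<dots> = (\<Sum>j<n. if j = l then c l * fact l * (- y) ^ l else 0)"
    using sumR van[OF l g] t by (simp only: add_0_right)
  finally show ?thesis using l by simp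
qed


section \<open>Partial fractions\<close>

text \<open>This is the coefficient of \<open>w\<^sup>l\<close> in the expansion of \<open>f\<close> in powers of the local parameter
  \<open>w = 1 - y z\<close> at \<open>z = 1 / y\<close>. The sign and the power of \<open>y\<close> come from \<open>d/dz = - y d/dw\<close>.\<close>

definition expansion_coeff :: "'a::field \<Rightarrow> 'a poly fract \<Rightarrow> nat \<Rightarrow> 'a" where
  "expansion_coeff y f l =
     (- 1) ^ l / (of_nat (fact l) * y ^ l) * fract_eval ((fract_deriv ^^ l) f) (inverse y)"

lemma expansion_coeff_in_subfield:
  assumes F: "subfield F" and y: "y \<in> F" and f: "f \<in> regular_at F (inverse y)"
  shows "expansion_coeff y f l \<in> F"
  unfolding expansion_coeff_def
  by (intro subfield_mult[OF F] subfield_divide[OF F] subfield_power[OF F] subfield_minus[OF F]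
      subfield_1[OF F] subfield_of_nat[OF F] y fract_eval_in_subfield[OF F]
      regular_at_deriv_iterate[OF F] f subfield_inverse[OF F])

lemma linear_power_eq:
  "y \<noteq> 0 \<Longrightarrow> [:1, - y:] ^ n = smult ((- y) ^ n) ([:- inverse y, 1:] ^ n)"
  for y :: "'a::field"
proof -
  assume "y \<noteq> 0"
  then have "[:1, - y:] = smult (- y) [:- inverse y, 1:]" by simp
  then show ?thesis by (simp only: smult_power)
qed

lemma linear_power_dvd_iff:
  "y \<noteq> 0 \<Longrightarrow> p \<noteq> 0 \<Longrightarrow> [:1, - y:] ^ n dvd p \<longleftrightarrow> n \<le> order (inverse y) p"
  for y :: "'a::field"
  by (simp add: linear_power_eq smult_dvd_iff order_divides)

text \<open>The Taylor polynomial of \<open>1 / P\<close> at a point is an inverse of \<open>P\<close> modulo the corresponding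
  power of a linear factor, since the remainder term has no pole there.\<close>

lemma inverse_mod_linear_power:
  fixes y :: "'a::field_char_0"
  assumes y: "y \<noteq> 0" and P: "poly P (inverse y) \<noteq> 0"
  shows "[:1, - y:] ^ n dvd (\<Sum>l<n. [:expansion_coeff y (Fract 1 P) l:] * [:1, - y:] ^ l) * P - 1"
proof -
  let ?w = "[:1, - y:]"
  have P0: "P \<noteq> 0" using P by auto
  have "Fract 1 P \<in> regular_at UNIV (inverse y)" using P by (auto intro: regular_atI)
  then obtain c g where g: "g \<in> regular_at UNIV (inverse y)"
    and f: "Fract 1 P = (\<Sum>l<n. Fract [:c l:] 1 * Fract ?w 1 ^ l) + Fract ?w 1 ^ n * g"
    using regular_expansion[OF y] by blast
  have c: "expansion_coeff y (Fract 1 P) l = c l" if "l < n" for l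
  proof -
    have "(- 1) ^ l * (- y) ^ l = y ^ l" by (simp add: power_mult_distrib[symmetric])
    then show ?thesis
      unfolding expansion_coeff_def fract_eval_deriv_expansion[OF y g f that]
      using y by (simp add: field_simps)
  qed
  define Q where "Q = (\<Sum>l<n. [:c l:] * ?w ^ l)"
  obtain a b where ab: "g = Fract a b" "poly b (inverse y) \<noteq> 0" "b \<noteq> 0"
    using g by (elim regular_atE)
  have "Fract 1 P = Fract Q 1 + Fract (?w ^ n * a) b"
    using f by (simp add: Q_def Fract_1_power Fract_1_sum ab)
  then have "b = (Q * b + ?w ^ n * a) * P"
    using P0 ab by (simp add: eq_fract)
  then have "b * (Q * P - 1) = ?w ^ n * (- a * P)" by (simp add: algebra_simps)
  then have dvd: "?w ^ n dvd b * (Q * P - 1)" by (metis dvd_triv_left)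
  have "?w ^ n dvd Q * P - 1"
  proof (cases "Q * P - 1 = 0")
    case False
    then have "n \<le> order (inverse y) (b * (Q * P - 1))"
      using dvd ab linear_power_dvd_iff[OF y] by (metis mult_eq_0_iff)
    also have "\<dots> = order (inverse y) (Q * P - 1)"
      using False ab by (simp add: order_mult order_0I)
    finally show ?thesis using False linear_power_dvd_iff[OF y] by blast
  qed simp
  moreover have "(\<Sum>l<n. [:expansion_coeff y (Fract 1 P) l:] * ?w ^ l) = Q"
    unfolding Q_def using c by (intro sum.cong) auto
  ultimately show ?thesis by simp
qed

text \<open>Modulo \<open>(1 - y i z) ^ m i\<close> only the summand of index \<open>i\<close> survives, and it is congruent to 1.
  So the difference of the two sides vanishes to order \<open>m i\<close> at each \<open>1 / y i\<close>. These are more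
  zeros than its degree allows for a nonzero polynomial.\<close>

lemma partial_fractions:
  fixes y :: "'i \<Rightarrow> 'a::field_char_0"
  assumes I: "finite I" "I \<noteq> {}" and inj: "inj_on y I" and y: "\<And>i. i \<in> I \<Longrightarrow> y i \<noteq> 0"
    and m: "\<And>i. i \<in> I \<Longrightarrow> m i > 0"
  defines "P \<equiv> \<lambda>i. \<Prod>j\<in>I - {i}. [:1, - y j:] ^ m j"
  shows "(\<Sum>i\<in>I. (\<Sum>l<m i. [:expansion_coeff (y i) (Fract 1 (P i)) l:] * [:1, - y i:] ^ l) * P i) = 1"
proof -
  define Q where "Q i = (\<Sum>l<m i. [:expansion_coeff (y i) (Fract 1 (P i)) l:] * [:1, - y i:] ^ l)" for i
  define R where "R = (\<Sum>i\<in>I. Q i * P i) - 1"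
  have deg_P: "degree (P i) = (\<Sum>j\<in>I - {i}. m j)" for i
    unfolding P_def using y
    by (subst degree_prod_eq_sum_degree) (auto simp: degree_power_eq intro!: sum.cong)
  have deg_Q: "degree (Q i) < m i" if i: "i \<in> I" for i
  proof -
    have "degree ([:c:] * [:1, - y i:] ^ l) \<le> l" for c l
      using degree_mult_le[of "[:c:]" "[:1, - y i:] ^ l"] y[OF i] by (simp add: degree_power_eq)
    then have "degree ([:c:] * [:1, - y i:] ^ l) \<le> m i - 1" if "l < m i" for c l
      by (rule order_trans) (use that in linarith)
    then have "degree (Q i) \<le> m i - 1"
      unfolding Q_def by (intro degree_sum_le) simp_all
    then show ?thesis using m[OF i] by simp
  qed
  have "degree (Q i * P i) < (\<Sum>j\<in>I. m j)" if i: "i \<in> I" for i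
    using degree_mult_le[of "Q i" "P i"] deg_Q[OF i] deg_P[of i] I(1) i
    by (simp add: sum.remove[of I i m])
  then have "degree (\<Sum>i\<in>I. Q i * P i) < (\<Sum>j\<in>I. m j)"
    using I m by (intro degree_sum_less) (auto intro!: sum_pos)
  then have deg_R: "degree R < (\<Sum>j\<in>I. m j)"
    unfolding R_def using I m by (intro degree_diff_less) (auto intro!: sum_pos)
  have dvd_R: "[:1, - y i:] ^ m i dvd R" if i: "i \<in> I" for i
  proof -
    have "poly (P i) (inverse (y i)) \<noteq> 0"
    proof -
      have "1 - inverse (y i) * y j \<noteq> 0" if "j \<in> I - {i}" for j
        using that i y[OF i] inj by (auto simp: field_simps dest: inj_onD)
      then show ?thesis using I(1) by (auto simp: P_def poly_prod)
    qed
    then have "[:1, - y i:] ^ m i dvd Q i * P i - 1"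
      unfolding Q_def using y[OF i] by (intro inverse_mod_linear_power)
    moreover have "[:1, - y i:] ^ m i dvd Q j * P j" if "j \<in> I - {i}" for j
      unfolding P_def using that i I(1)
      by (intro dvd_mult dvd_prodI[of "I - {j}" i "\<lambda>j. [:1, - y j:] ^ m j"]) auto
    then have "[:1, - y i:] ^ m i dvd (\<Sum>j\<in>I - {i}. Q j * P j)" by (rule dvd_sum)
    ultimately have "[:1, - y i:] ^ m i dvd (Q i * P i - 1) + (\<Sum>j\<in>I - {i}. Q j * P j)"
      by (rule dvd_add)
    then show ?thesis using I(1) i by (simp add: R_def sum.remove[of I i] algebra_simps)
  qed
  have "R = 0"
  proof (rule ccontr)
    assume R: "R \<noteq> 0"
    have inj': "inj_on (\<lambda>i. inverse (y i)) I"
      using inj by (auto simp: inj_on_def)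
    have fin: "finite {x. poly R x = 0}" using R by (rule poly_roots_finite)
    have ord: "m i \<le> order (inverse (y i)) R" if "i \<in> I" for i
      using dvd_R[OF that] linear_power_dvd_iff[OF y[OF that] R] by blast
    have "(\<Sum>j\<in>I. m j) \<le> (\<Sum>i\<in>I. order (inverse (y i)) R)"
      using ord by (rule sum_mono)
    also have "\<dots> = (\<Sum>x\<in>(\<lambda>i. inverse (y i)) ` I. order x R)"
      using inj' by (simp add: sum.reindex)
    also have "\<dots> \<le> (\<Sum>x | poly R x = 0. order x R)"
    proof (rule sum_mono2[OF fin])
      show "(\<lambda>i. inverse (y i)) ` I \<subseteq> {x. poly R x = 0}"
        using ord m R by (force simp: order_root)
    qed simp
    also have "\<dots> \<le> degree R" by (rule sum_order_le_degree[OF R])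
    finally show False using deg_R by simp
  qed
  then show ?thesis by (simp add: R_def Q_def)
qed

text \<open>This is the binomial series of \<open>1 / (1 - y z)\<^sup>k\<close>. For \<open>k = 0\<close> the truncated subtraction gives
  \<open>N - 1\<close> over \<open>N\<close>, which is 1 for \<open>N = 0\<close> and 0 otherwise, as it should be.\<close>

definition geometric_power_series :: "'a::field \<Rightarrow> nat \<Rightarrow> 'a fps" where
  "geometric_power_series y k = Abs_fps (\<lambda>N. of_nat ((N + k - 1) choose N) * y ^ N)"

lemma geometric_power_series_mult:
  "geometric_power_series y k * (1 - fps_const y * fps_X) ^ k = 1"
proof (induction k)
  case 0
  have "fps_nth (geometric_power_series y 0) N = fps_nth 1 N" for N
    by (cases N) (simp_all add: geometric_power_series_def binomial_eq_0)
  then show ?case by (simp add: fps_eq_iff)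
next
  case (Suc k)
  have "geometric_power_series y (Suc k) * (1 - fps_const y * fps_X) = geometric_power_series y k"
  proof (rule fps_ext)
    fix N
    have "geometric_power_series y (Suc k) * (1 - fps_const y * fps_X)
        = geometric_power_series y (Suc k) - fps_const y * (geometric_power_series y (Suc k) * fps_X)"
      by (simp add: algebra_simps)
    then show "fps_nth (geometric_power_series y (Suc k) * (1 - fps_const y * fps_X)) N
        = fps_nth (geometric_power_series y k) N"
      by (cases N) (simp_all add: geometric_power_series_def algebra_simps)
  qed
  then show ?case using Suc by (simp add: mult.assoc[symmetric])
qed

text \<open>Read as an identity of power series, the partial fraction decomposition gives the
  coefficients of \<open>\<Prod>\<^sub>i 1 / (1 - y\<^sub>i z) ^ m\<^sub>i\<close>.\<close>

lemma partial_fractions_series: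
  fixes y :: "'i \<Rightarrow> 'a::field_char_0"
  assumes I: "finite I" "I \<noteq> {}" and inj: "inj_on y I" and y: "\<And>i. i \<in> I \<Longrightarrow> y i \<noteq> 0"
    and m: "\<And>i. i \<in> I \<Longrightarrow> m i > 0"
  defines "P \<equiv> \<lambda>i. \<Prod>j\<in>I - {i}. [:1, - y j:] ^ m j"
  shows "(\<Sum>i\<in>I. \<Sum>k=1..m i. fps_const (expansion_coeff (y i) (Fract 1 (P i)) (m i - k))
        * geometric_power_series (y i) k) * (\<Prod>i\<in>I. (1 - fps_const (y i) * fps_X) ^ m i) = 1"
    (is "?S * ?D = 1")
proof -
  let ?w = "\<lambda>i. 1 - fps_const (y i) * fps_X"
  let ?a = "\<lambda>i. expansion_coeff (y i) (Fract 1 (P i))"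
  have w: "fps_of_poly [:1, - y i:] = ?w i" for i
    by (simp add: fps_of_poly_pCons fps_const_neg[symmetric] del: fps_const_neg)
  have fps_P: "fps_of_poly (P i) = (\<Prod>j\<in>I - {i}. ?w j ^ m j)" for i
    unfolding P_def by (simp add: fps_of_poly_prod fps_of_poly_power w)
  have summand: "(\<Sum>k=1..m i. fps_const (?a i (m i - k)) * geometric_power_series (y i) k) * ?D
      = fps_of_poly ((\<Sum>l<m i. [:?a i l:] * [:1, - y i:] ^ l) * P i)" if i: "i \<in> I" for i
  proof -
    have "geometric_power_series (y i) k * ?w i ^ m i = ?w i ^ (m i - k)" if "k \<le> m i" for k
    proof -
      have "?w i ^ m i = ?w i ^ k * ?w i ^ (m i - k)"
        unfolding power_add[symmetric] using that by (simp only: le_add_diff_inverse)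
      then show ?thesis
        by (simp only: mult.assoc[symmetric] geometric_power_series_mult mult_1)
    qed
    then have "(\<Sum>k=1..m i. fps_const (?a i (m i - k)) * geometric_power_series (y i) k) * ?w i ^ m i
        = (\<Sum>k=1..m i. fps_const (?a i (m i - k)) * ?w i ^ (m i - k))"
      by (simp add: sum_distrib_right mult.assoc)
    also have "\<dots> = (\<Sum>l<m i. fps_const (?a i l) * ?w i ^ l)"
      by (rule sum.reindex_bij_witness[of _ "\<lambda>l. m i - l" "\<lambda>k. m i - k"]) auto
    also have "\<dots> = fps_of_poly (\<Sum>l<m i. [:?a i l:] * [:1, - y i:] ^ l)"
      by (simp add: fps_of_poly_sum fps_of_poly_mult fps_of_poly_power fps_of_poly_smult w)
    finally show ?thesis
      using I(1) i
      by (simp add: fps_of_poly_mult fps_P prod.remove[of I i] mult.assoc[symmetric])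
  qed
  have "?S * ?D = fps_of_poly (\<Sum>i\<in>I. (\<Sum>l<m i. [:?a i l:] * [:1, - y i:] ^ l) * P i)"
    unfolding sum_distrib_right[of _ I] fps_of_poly_sum using summand by (intro sum.cong) auto
  then show ?thesis
    using partial_fractions[OF I inj y m] by (simp add: P_def)
qed


section \<open>Complete homogeneous symmetric polynomials\<close>

lemma multisets_over_0: "multisets_over B 0 = {{#}}"
  by (auto simp: multisets_over_def)

lemma multisets_over_insert_Suc:
  "multisets_over (insert b B) (Suc N) = multisets_over B (Suc N) \<union> add_mset b ` multisets_over (insert b B) N"
proof (intro equalityI subsetI)
  fix M assume M: "M \<in> multisets_over (insert b B) (Suc N)"
  show "M \<in> multisets_over B (Suc N) \<union> add_mset b ` multisets_over (insert b B) N"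
  proof (cases "b \<in># M")
    case True
    then obtain L where "M = add_mset b L" by (metis insert_DiffM)
    then show ?thesis using M by (auto simp: multisets_over_def)
  qed (use M in \<open>auto simp: multisets_over_def\<close>)
qed (auto simp: multisets_over_def)

text \<open>A monomial in one more variable \<open>b\<close> either does not contain \<open>b\<close> or is \<open>b\<close> times a
  monomial of smaller degree. Hence multiplication by \<open>1 - x\<^sub>b z\<close> removes the variable.\<close>

lemma complete_homogeneous_series:
  fixes x :: "'b \<Rightarrow> 'a::field"
  assumes "finite B"
  shows "Abs_fps (\<lambda>N. \<Sum>M\<in>multisets_over B N. \<Prod>e\<in>#M. x e) * (\<Prod>e\<in>B. 1 - fps_const (x e) * fps_X) = 1"
  using assms
proof (induction B)
  case empty
  have "fps_nth (Abs_fps (\<lambda>N. \<Sum>M\<in>multisets_over {} N. \<Prod>e\<in>#M. x e)) N = fps_nth 1 N" for N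
  proof (cases N)
    case (Suc n)
    then have "multisets_over {} N = ({} :: 'b multiset set)" by (auto simp: multisets_over_def)
    then show ?thesis using Suc by simp
  qed (simp add: multisets_over_0)
  then show ?case by (simp add: fps_eq_iff)
next
  case (insert b B)
  let ?h = "\<lambda>B N. \<Sum>M\<in>multisets_over B N. \<Prod>e\<in>#M. x e"
  have rec: "?h (insert b B) (Suc N) = ?h B (Suc N) + x b * ?h (insert b B) N" for N
  proof -
    have "multisets_over B (Suc N) \<inter> add_mset b ` multisets_over (insert b B) N = {}"
      using insert.hyps by (auto simp: multisets_over_def)
    then have "?h (insert b B) (Suc N)
        = ?h B (Suc N) + (\<Sum>M\<in>add_mset b ` multisets_over (insert b B) N. \<Prod>e\<in>#M. x e)"
      unfolding multisets_over_insert_Suc using insert.hyps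
      by (intro sum.union_disjoint) (simp_all add: finite_multisets_over)
    also have "(\<Sum>M\<in>add_mset b ` multisets_over (insert b B) N. \<Prod>e\<in>#M. x e) = x b * ?h (insert b B) N"
      by (simp add: sum.reindex inj_on_def sum_distrib_left)
    finally show ?thesis .
  qed
  have "Abs_fps (?h (insert b B)) * (1 - fps_const (x b) * fps_X) = Abs_fps (?h B)"
  proof (rule fps_ext)
    fix N
    have "Abs_fps (?h (insert b B)) * (1 - fps_const (x b) * fps_X)
        = Abs_fps (?h (insert b B)) - fps_const (x b) * (Abs_fps (?h (insert b B)) * fps_X)"
      by (simp add: algebra_simps)
    then show "fps_nth (Abs_fps (?h (insert b B)) * (1 - fps_const (x b) * fps_X)) N
        = fps_nth (Abs_fps (?h B)) N"
      by (cases N) (simp_all add: rec multisets_over_0)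
  qed
  then show ?case
    using insert by (simp add: mult.assoc[symmetric])
qed

text \<open>Variables with equal values are collected: if each \<open>y i\<close> is taken \<open>m i\<close> times, then the
  generating function is \<open>\<Prod>\<^sub>i 1 / (1 - y\<^sub>i z) ^ m\<^sub>i\<close>. The sum of partial fractions is a power
  series inverse of the same polynomial, so the coefficients agree.\<close>

lemma complete_homogeneous_partial_fractions:
  fixes y :: "'i \<Rightarrow> 'a::field_char_0" and c :: "'b \<Rightarrow> 'i"
  assumes B: "finite B" "B \<noteq> {}" and inj: "inj_on y (c ` B)" and y: "\<And>i. i \<in> c ` B \<Longrightarrow> y i \<noteq> 0"
    and m: "\<And>i. i \<in> c ` B \<Longrightarrow> m i = card {e\<in>B. c e = i}"
  defines "P \<equiv> \<lambda>i. \<Prod>j\<in>c ` B - {i}. [:1, - y j:] ^ m j"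
  shows "(\<Sum>M\<in>multisets_over B N. \<Prod>e\<in>#M. y (c e))
    = (\<Sum>i\<in>c ` B. y i ^ N * (\<Sum>k=1..m i.
        expansion_coeff (y i) (Fract 1 (P i)) (m i - k) * of_nat ((N + k - 1) choose N)))"
proof -
  let ?a = "\<lambda>i. expansion_coeff (y i) (Fract 1 (P i))"
  let ?H = "Abs_fps (\<lambda>N. \<Sum>M\<in>multisets_over B N. \<Prod>e\<in>#M. y (c e))"
  let ?S = "\<Sum>i\<in>c ` B. \<Sum>k=1..m i. fps_const (?a i (m i - k)) * geometric_power_series (y i) k"
  let ?D = "\<Prod>i\<in>c ` B. (1 - fps_const (y i) * fps_X) ^ m i"
  have mpos: "m i > 0" if "i \<in> c ` B" for i
    using m[OF that] that B(1) by (auto simp: card_gt_0_iff)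
  have S: "?S * ?D = 1"
    unfolding P_def using B y mpos by (intro partial_fractions_series inj) auto
  have "?D = (\<Prod>i\<in>c ` B. \<Prod>e\<in>{e\<in>B. c e = i}. 1 - fps_const (y (c e)) * fps_X)"
    by (intro prod.cong refl) (simp add: m)
  also have "\<dots> = (\<Prod>e\<in>B. 1 - fps_const (y (c e)) * fps_X)"
    using B(1) by (intro prod.group) auto
  finally have "?H * ?D = 1"
    using complete_homogeneous_series[OF B(1), of "\<lambda>e. y (c e)"] by (simp only:)
  moreover have "p = q" if "p * d = 1" "q * d = 1" for p q d :: "'a fps"
    using that by (metis mult.assoc mult.commute mult_1)
  ultimately have "?H = ?S" using S by blast
  then have "fps_nth ?H N = fps_nth ?S N" by (rule arg_cong)
  then show ?thesis
    by (simp add: fps_sum_nth geometric_power_series_def sum_distrib_left mult_ac)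
qed


section \<open>Characters as rational functions\<close>

text \<open>This makes the factorials in the Taylor coefficients invertible.\<close>

instance fract :: ("{idom, ring_char_0}") field_char_0
proof
  show "inj (of_nat :: nat \<Rightarrow> 'a fract)"
    by (rule injI) (simp add: of_nat_fract eq_fract)
qed

lemma one_divide_Fract: "1 / Fract a 1 = Fract 1 a"
  by (simp add: One_fract_def)

lemma weight_lattice_add: "c \<in> weight_lattice r \<Longrightarrow> d \<in> weight_lattice r \<Longrightarrow> c + d \<in> weight_lattice r"
  using Poly_Mapping.keys_add[of c d] by (auto simp: weight_lattice_def)

lemma weight_lattice_0: "0 \<in> weight_lattice r"
  by (simp add: weight_lattice_def)

lemma weight_lattice_sum_mset:
  "(\<And>e. e \<in># M \<Longrightarrow> c e \<in> weight_lattice r) \<Longrightarrow> (\<Sum>e\<in>#M. c e) \<in> weight_lattice r"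
  by (induction M) (auto intro: weight_lattice_0 weight_lattice_add)

lemma subfield_rational_functions: "subfield (rational_functions r)"
proof -
  let ?K = "\<lambda>p :: weight \<Rightarrow>\<^sub>0 complex. Poly_Mapping.keys p \<subseteq> weight_lattice r"
  have mult: "?K (p * q)" if "?K p" "?K q" for p q
    using keys_mult[of p q] that weight_lattice_add by blast
  have diff: "?K (p - q)" if "?K p" "?K q" for p q
    using keys_diff[of p q] that by blast
  have one: "?K 1" by (simp add: weight_lattice_0)
  have mem: "Fract p q \<in> rational_functions r" if "?K p" "?K q" "q \<noteq> 0" for p q
    using that by (auto simp: rational_functions_def)
  have "1 \<in> rational_functions r"
    unfolding One_fract_def by (intro mem one) simp
  moreover have "x - y \<in> rational_functions r \<and> x * y \<in> rational_functions r"
    if "x \<in> rational_functions r" "y \<in> rational_functions r" for x y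
  proof -
    obtain p q where x: "x = Fract p q" "?K p" "?K q" "q \<noteq> 0"
      using \<open>x \<in> rational_functions r\<close> by (auto simp: rational_functions_def)
    obtain p' q' where y: "y = Fract p' q'" "?K p'" "?K q'" "q' \<noteq> 0"
      using \<open>y \<in> rational_functions r\<close> by (auto simp: rational_functions_def)
    show ?thesis
      using x y by (simp add: mem mult diff)
  qed
  moreover have "inverse x \<in> rational_functions r" if x_in: "x \<in> rational_functions r" for x
  proof -
    obtain p q where x: "x = Fract p q" "?K p" "?K q" "q \<noteq> 0"
      using x_in by (auto simp: rational_functions_def)
    show ?thesis
    proof (cases "p = 0")
      case True
      then have "x = Fract 0 1" using x by (simp add: eq_fract)
      then have "inverse x = Fract 0 1" by (simp add: Zero_fract_def[symmetric])
      then show ?thesis using mem[of 0 1] one by simp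
    qed (use x in \<open>simp add: mem\<close>)
  qed
  ultimately show ?thesis by (simp add: subfield_def)
qed

lemma qpow_in_rational_functions: "c \<in> weight_lattice r \<Longrightarrow> qpow c \<in> rational_functions r"
  unfolding rational_functions_def qpow_def mem_Collect_eq
  by (rule exI[of _ "Poly_Mapping.single c 1"], rule exI[of _ 1]) (simp add: weight_lattice_0)

lemma qpow_add: "qpow (c + d) = qpow c * qpow d"
  by (simp add: qpow_def mult_single)

lemma qpow_sum_mset: "qpow (\<Sum>e\<in>#M. c e) = (\<Prod>e\<in>#M. qpow (c e))"
  by (induction M) (simp_all add: qpow_add, simp add: qpow_def One_fract_def)

lemma inj_qpow: "inj qpow"
  by (rule injI) (auto simp: qpow_def eq_fract dest: arg_cong[of _ _ Poly_Mapping.keys])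

lemma qpow_nonzero: "qpow c \<noteq> 0"
  by (auto simp: qpow_def Zero_fract_def eq_fract dest: arg_cong[of _ _ Poly_Mapping.keys])

lemma ratfun_const_of_nat: "ratfun_const (of_nat n) = of_nat n"
  by (simp add: ratfun_const_def of_nat_fract)

lemma laurent_to_ratfun_0: "laurent_to_ratfun 0 = 0"
proof -
  have "Poly_Mapping.map of_int 0 = (0 :: weight \<Rightarrow>\<^sub>0 complex)"
    by (rule poly_mapping_eqI) (simp add: Poly_Mapping.map.rep_eq)
  then show ?thesis by (simp add: laurent_to_ratfun_def Zero_fract_def)
qed

lemma laurent_to_ratfun_add: "laurent_to_ratfun (p + q) = laurent_to_ratfun p + laurent_to_ratfun q"
proof -
  have "Poly_Mapping.map of_int (p + q) = Poly_Mapping.map of_int p + (Poly_Mapping.map of_int q :: weight \<Rightarrow>\<^sub>0 complex)"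
    by (rule poly_mapping_eqI) (simp add: Poly_Mapping.map.rep_eq lookup_add when_def of_int_add[symmetric] del: of_int_add)
  then show ?thesis by (simp add: laurent_to_ratfun_def)
qed

lemma laurent_to_ratfun_sum: "laurent_to_ratfun (\<Sum>i\<in>I. f i) = (\<Sum>i\<in>I. laurent_to_ratfun (f i))"
  by (induction I rule: infinite_finite_induct) (simp_all add: laurent_to_ratfun_0 laurent_to_ratfun_add)

lemma laurent_to_ratfun_single:
  "laurent_to_ratfun (Poly_Mapping.single c (int n)) = of_nat n * qpow c"
proof -
  have "Poly_Mapping.map of_int (Poly_Mapping.single c (int n)) = Poly_Mapping.single c (of_nat n :: complex)"
    by (rule poly_mapping_eqI) (simp add: Poly_Mapping.map.rep_eq lookup_single when_def)
  also have "\<dots> = of_nat n * Poly_Mapping.single c 1"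
    by (metis add_0 mult.right_neutral mult_single single_of_nat)
  finally show ?thesis
    by (simp add: laurent_to_ratfun_def qpow_def of_nat_fract)
qed

lemma wt_superset:
  "finite S \<Longrightarrow> Poly_Mapping.keys c \<subseteq> S \<Longrightarrow> wt \<omega> c t = (\<Sum>i\<in>S. of_int (Poly_Mapping.lookup c i) * \<omega> i t)"
  unfolding wt_def by (intro sum.mono_neutral_left) (auto simp: in_keys_iff)

lemma wt_add: "wt \<omega> (c + d) t = wt \<omega> c t + wt \<omega> d t"
proof -
  let ?S = "Poly_Mapping.keys c \<union> Poly_Mapping.keys d"
  have "wt \<omega> (c + d) t = (\<Sum>i\<in>?S. of_int (Poly_Mapping.lookup (c + d) i) * \<omega> i t)"
    using Poly_Mapping.keys_add[of c d] by (intro wt_superset) auto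
  also have "\<dots> = wt \<omega> c t + wt \<omega> d t"
    by (subst (1 2) wt_superset[of ?S]) (auto simp: lookup_add distrib_right sum.distrib)
  finally show ?thesis .
qed

lemma wt_sum_mset: "wt \<omega> (\<Sum>e\<in>#M. c e) t = (\<Sum>e\<in>#M. wt \<omega> (c e) t)"
  by (induction M) (simp_all add: wt_add, simp add: wt_def)

lemma weight_mult_basis:
  assumes "\<And>t. clinear (\<rho> t)"
    and B: "finite B" "cvec.independent B" "cvec.span B = UNIV"
    and c: "\<And>e. e \<in> B \<Longrightarrow> c e \<in> weight_lattice r"
    and e: "\<And>e. e \<in> B \<Longrightarrow> e \<in> weight_space h UNIV \<rho> (wt \<omega> (c e))"
    and \<omega>: "fundamental_weights h r co \<omega>" and co: "\<And>j. j \<in> {1..r} \<Longrightarrow> co j \<in> h"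
    and \<mu>: "\<mu> \<in> weight_lattice r"
  shows "weight_mult h \<omega> UNIV \<rho> \<mu> = card {e\<in>B. c e = \<mu>}"
proof -
  have "weight_mult h \<omega> UNIV \<rho> \<mu> = cvec.dim (weight_space h (cvec.span ((\<lambda>e. e) ` B)) \<rho> (wt \<omega> \<mu>))"
    using B by (simp add: weight_mult_def)
  also have "\<dots> = card {e\<in>B. \<forall>t\<in>h. wt \<omega> (c e) t = wt \<omega> \<mu> t}"
    using assms by (intro dim_weight_space_eq_card) (auto simp: weight_space_def)
  also have "{e\<in>B. \<forall>t\<in>h. wt \<omega> (c e) t = wt \<omega> \<mu> t} = {e\<in>B. c e = \<mu>}"
    using wt_eq_iff[OF \<omega> co c \<mu>] by blast
  finally show ?thesis .
qed

text \<open>By the Leibniz rule a product of weight vectors is a weight vector for the sum of the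
  weights. So the monomials in a basis of weight vectors form a basis of the symmetric power that
  consists of weight vectors.\<close>

lemma weight_mult_sym_power:
  assumes lin: "\<And>t. clinear (\<rho> t)"
    and B: "finite B" "cvec.independent B" "cvec.span B = UNIV"
    and c: "\<And>e. e \<in> B \<Longrightarrow> c e \<in> weight_lattice r"
    and e: "\<And>e. e \<in> B \<Longrightarrow> e \<in> weight_space h UNIV \<rho> (wt \<omega> (c e))"
    and \<omega>: "fundamental_weights h r co \<omega>" and co: "\<And>j. j \<in> {1..r} \<Longrightarrow> co j \<in> h"
    and \<mu>: "\<mu> \<in> weight_lattice r"
  shows "weight_mult h \<omega> (sym_power N) (\<lambda>x. sym_action (\<rho> x)) \<mu>
    = card {M\<in>multisets_over B N. (\<Sum>e\<in>#M. c e) = \<mu>}"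
proof -
  have "weight_mult h \<omega> (sym_power N) (\<lambda>x. sym_action (\<rho> x)) \<mu>
      = cvec.dim (weight_space h (cvec.span (sym_prod ` multisets_over B N)) (\<lambda>x. sym_action (\<rho> x)) (wt \<omega> \<mu>))"
    by (simp add: weight_mult_def sym_power_eq_span[OF B(3)])
  also have "\<dots> = card {M\<in>multisets_over B N. \<forall>t\<in>h. wt \<omega> (\<Sum>e\<in>#M. c e) t = wt \<omega> \<mu> t}"
  proof (rule dim_weight_space_eq_card)
    show "sym_action (\<rho> t) (sym_prod M) = wt \<omega> (\<Sum>e\<in>#M. c e) t *c sym_prod M"
      if "M \<in> multisets_over B N" "t \<in> h" for M t
      unfolding wt_sum_mset using that e
      by (intro sym_action_eigenvectors lin) (auto simp: multisets_over_def weight_space_def)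
  qed (simp_all add: finite_multisets_over sym_prod_inj_on sym_prod_image_independent B clinear_sym_action)
  also have "{M\<in>multisets_over B N. \<forall>t\<in>h. wt \<omega> (\<Sum>e\<in>#M. c e) t = wt \<omega> \<mu> t}
      = {M\<in>multisets_over B N. (\<Sum>e\<in>#M. c e) = \<mu>}"
  proof -
    have "(\<Sum>e\<in>#M. c e) \<in> weight_lattice r" if "M \<in> multisets_over B N" for M
      using that c by (intro weight_lattice_sum_mset) (auto simp: multisets_over_def)
    then show ?thesis using wt_eq_iff[OF \<omega> co _ \<mu>] by blast
  qed
  finally show ?thesis .
qed

text \<open>Each monomial in the basis contributes \<open>q\<close> to the power of its weight. In sum this is the
  complete homogeneous symmetric polynomial of degree \<open>N\<close>, evaluated at the monomials
  \<open>qpow (c e)\<close>.\<close>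

lemma character_sym_power:
  assumes lin: "\<And>t. clinear (\<rho> t)"
    and B: "finite B" "cvec.independent B" "cvec.span B = UNIV"
    and c: "\<And>e. e \<in> B \<Longrightarrow> c e \<in> weight_lattice r"
    and e: "\<And>e. e \<in> B \<Longrightarrow> e \<in> weight_space h UNIV \<rho> (wt \<omega> (c e))"
    and \<omega>: "fundamental_weights h r co \<omega>" and co: "\<And>j. j \<in> {1..r} \<Longrightarrow> co j \<in> h"
  shows "laurent_to_ratfun (character r h \<omega> (sym_power N) (\<lambda>x. sym_action (\<rho> x)))
    = (\<Sum>M\<in>multisets_over B N. \<Prod>e\<in>#M. qpow (c e))"
proof -
  let ?MS = "multisets_over B N" and ?wt = "\<lambda>M. \<Sum>e\<in>#M. c e"
  let ?mult = "weight_mult h \<omega> (sym_power N) (\<lambda>x. sym_action (\<rho> x))"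
  have fin: "finite ?MS" using B(1) by (rule finite_multisets_over)
  have mult: "?mult \<mu> = card {M\<in>?MS. ?wt M = \<mu>}" if "\<mu> \<in> weight_lattice r" for \<mu>
    by (rule weight_mult_sym_power[OF lin B c e \<omega> co that])
  have wtX: "?wt M \<in> weight_lattice r" if "M \<in> ?MS" for M
    using that c by (intro weight_lattice_sum_mset) (auto simp: multisets_over_def)
  have "{\<mu>. \<mu> \<in> weight_lattice r \<and> ?mult \<mu> \<noteq> 0} = ?wt ` ?MS"
    using wtX fin by (auto simp: mult card_gt_0_iff)
  then have "laurent_to_ratfun (character r h \<omega> (sym_power N) (\<lambda>x. sym_action (\<rho> x)))
      = (\<Sum>\<mu>\<in>?wt ` ?MS. of_nat (?mult \<mu>) * qpow \<mu>)"
    by (simp add: character_def laurent_to_ratfun_sum laurent_to_ratfun_single)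
  also have "\<dots> = (\<Sum>\<mu>\<in>?wt ` ?MS. \<Sum>M\<in>{M\<in>?MS. ?wt M = \<mu>}. qpow (?wt M))"
    using wtX by (intro sum.cong refl) (auto simp: mult)
  also have "\<dots> = (\<Sum>M\<in>?MS. qpow (?wt M))"
    using fin by (intro sum.group) auto
  finally show ?thesis by (simp add: qpow_sum_mset)
qed


section \<open>The character formula\<close>

definition binomial_poly :: "nat \<Rightarrow> rat poly" where
  "binomial_poly k = smult (1 / fact (k - 1)) (\<Prod>i=1..k - 1. [:of_nat i, 1:])"

lemma degree_binomial_poly: "degree (binomial_poly k) = k - 1"
  unfolding binomial_poly_def by (simp add: degree_prod_eq_sum_degree)

lemma poly_binomial_poly:
  assumes "k \<ge> 1"
  shows "poly (binomial_poly k) (of_nat N) = of_nat ((N + k - 1) choose N)"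
proof -
  obtain j where k: "k = Suc j" using assms by (cases k) auto
  have "fact (N + j) = fact N * (\<Prod>i=1..j. of_nat i + of_nat N :: rat)"
    by (induction j) (simp_all add: algebra_simps)
  then show ?thesis
    by (simp add: k binomial_poly_def poly_prod binomial_fact)
qed

theorem theorem3p4:
  fixes br :: "'g::complex_vector \<Rightarrow> 'g \<Rightarrow> 'g"
    and h b :: "'g set"
    and r :: nat
    and \<alpha> :: "nat \<Rightarrow> 'g \<Rightarrow> complex"
    and co :: "nat \<Rightarrow> 'g"
    and \<omega> :: "nat \<Rightarrow> 'g \<Rightarrow> complex"
    and \<rho> :: "'g \<Rightarrow> 'v::complex_vector \<Rightarrow> 'v"
    and lam :: weight
    and X :: "weight set"
    and m :: "weight \<Rightarrow> nat"
  assumes semisimple: "semisimple_lie_algebra br"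
    and cartan: "cartan_subalgebra br h"
    and borel: "borel_subalgebra br b" "h \<subseteq> b"
    and rank: "r = cvec.dim h"
    and simple_roots: "bij_betw \<alpha> {1..r} (simple_roots br h b)"
    and simple_coroots: "\<forall>i\<in>{1..r}. is_coroot br h (\<alpha> i) (co i)"
    and fundamental: "fundamental_weights h r co \<omega>"
    and X_def: "X = weight_lattice r"
    and irreducible: "irreducible_representation br \<rho>"
    and dominant: "lam \<in> dominant_weights r"
    and highest: "highest_weight br h b \<omega> \<rho> lam"
    and m_def: "m = weight_mult h \<omega> UNIV \<rho>"
  shows "\<exists>p :: nat \<Rightarrow> rat poly.
      (\<forall>k\<ge>1. degree (p k) = k - 1 \<and>
        (\<forall>N. poly (p k) (of_nat N) = of_nat ((N + k - 1) choose N))) \<and>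
      (\<exists>A :: weight \<Rightarrow> nat \<Rightarrow> ratfun.
        (\<forall>\<nu>\<in>X. \<forall>k\<in>{1..m \<nu>}. A \<nu> k \<in> rational_functions r) \<and>
        (\<forall>N::nat.
          laurent_to_ratfun (character r h \<omega> (sym_power N) (\<lambda>x. sym_action (\<rho> x)))
            = (\<Sum>\<nu> | \<nu> \<in> X \<and> m \<nu> \<noteq> 0. qpow \<nu> ^ N *
                (\<Sum>k = 1..m \<nu>. A \<nu> k * ratfun_const (of_rat (poly (p k) (of_nat N)))))) \<and>
        (\<forall>\<mu>\<in>X. \<forall>l<m \<mu>.
          A \<mu> (m \<mu> - l) = (- 1) ^ l / (of_nat (fact l) * qpow \<mu> ^ l) *
            fract_eval
              ((fract_deriv ^^ l)
                (\<Prod>\<nu> \<in> {\<nu> \<in> X. m \<nu> \<noteq> 0} - {\<mu>}. 1 / (Fract [:1, - qpow \<nu>:] 1) ^ m \<nu>))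
              (inverse (qpow \<mu>))))"
proof (intro exI[of _ binomial_poly] conjI)
  show "\<forall>k\<ge>1. degree (binomial_poly k) = k - 1 \<and>
      (\<forall>N. poly (binomial_poly k) (of_nat N) = of_nat ((N + k - 1) choose N))"
    by (simp add: degree_binomial_poly poly_binomial_poly)
next
  have rep: "representation br \<rho>" using irreducible by (simp add: irreducible_representation_def)
  note lin = representationD(1)[OF rep]
  have co: "co j \<in> h" if "j \<in> {1..r}" for j
    using simple_coroots that by (simp add: is_coroot_def)
  \<comment> \<open>The weights \<open>c e\<close> of the basis vectors \<open>e\<close> run through the \<open>\<nu>\<close> with \<open>m \<nu> \<noteq> 0\<close>,
    each repeated \<open>m \<nu>\<close> times.\<close>
  obtain B c where B: "finite B" "cvec.independent B" "cvec.span B = UNIV" and ne: "B \<noteq> {}"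
    and c: "\<And>e. e \<in> B \<Longrightarrow> c e \<in> weight_lattice r"
    and e: "\<And>e. e \<in> B \<Longrightarrow> e \<in> weight_space h UNIV \<rho> (wt \<omega> (c e))"
    using semisimple simple_coroots
    by (elim weight_basis[OF _ _ cartan rank _ fundamental irreducible highest, rotated 3])
      (auto simp: semisimple_lie_algebra_def)
  have m: "m \<mu> = card {e\<in>B. c e = \<mu>}" if "\<mu> \<in> X" for \<mu>
    unfolding m_def
    by (rule weight_mult_basis[OF lin B c e fundamental co]) (use that X_def in auto)
  have I: "{\<nu>. \<nu> \<in> X \<and> m \<nu> \<noteq> 0} = c ` B"
    using B(1) c by (auto simp: m X_def card_gt_0_iff)
  let ?I = "{\<nu>. \<nu> \<in> X \<and> m \<nu> \<noteq> 0}"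
  let ?F = "rational_functions r"
  note F = subfield_rational_functions[of r]
  define P where "P \<mu> = (\<Prod>\<nu>\<in>c ` B - {\<mu>}. [:1, - qpow \<nu>:] ^ m \<nu>)" for \<mu>
  let ?f = "\<lambda>\<mu>. \<Prod>\<nu>\<in>?I - {\<mu>}. 1 / Fract [:1, - qpow \<nu>:] 1 ^ m \<nu>"
  have f_eq: "?f \<mu> = Fract 1 (P \<mu>)" for \<mu>
  proof -
    have "?f \<mu> = 1 / Fract (P \<mu>) 1"
      unfolding I P_def Fract_1_prod[symmetric] Fract_1_power[symmetric] by (simp add: prod_dividef)
    then show ?thesis by (simp only: one_divide_Fract)
  qed
  define A where "A \<mu> k = expansion_coeff (qpow \<mu>) (?f \<mu>) (m \<mu> - k)" for \<mu> k
  have "A \<mu> k \<in> ?F" if \<mu>: "\<mu> \<in> X" for \<mu> k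
    unfolding A_def
  proof (rule expansion_coeff_in_subfield[OF F])
    show "qpow \<mu> \<in> ?F" using \<mu> by (simp add: X_def qpow_in_rational_functions)
    show "?f \<mu> \<in> regular_at ?F (inverse (qpow \<mu>))"
    proof (rule regular_at_prod[OF F])
      fix \<nu> assume \<nu>: "\<nu> \<in> ?I - {\<mu>}"
      then have "qpow \<nu> \<noteq> qpow \<mu>" using inj_qpow by (auto dest: injD)
      then have nz: "poly [:1, - qpow \<nu>:] (inverse (qpow \<mu>)) \<noteq> 0"
        using qpow_nonzero[of \<mu>] by (simp add: field_simps)
      have "coeffs_in ?F [:1, - qpow \<nu>:]"
        using \<nu> by (intro coeffs_pCons[OF F] coeffs_0[OF F] subfield_1[OF F] subfield_minus[OF F]
            qpow_in_rational_functions) (simp add: X_def)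
      then have "Fract 1 [:1, - qpow \<nu>:] \<in> regular_at ?F (inverse (qpow \<mu>))"
        using nz by (intro regular_atI coeffs_1[OF F])
      then have "Fract 1 [:1, - qpow \<nu>:] ^ m \<nu> \<in> regular_at ?F (inverse (qpow \<mu>))"
        by (rule regular_at_power[OF F])
      moreover have "1 / Fract [:1, - qpow \<nu>:] 1 ^ m \<nu> = Fract 1 [:1, - qpow \<nu>:] ^ m \<nu>"
        by (simp only: power_one_over[symmetric] one_divide_Fract)
      ultimately show "1 / Fract [:1, - qpow \<nu>:] 1 ^ m \<nu> \<in> regular_at ?F (inverse (qpow \<mu>))"
        by simp
    qed
  qed
  moreover have "laurent_to_ratfun (character r h \<omega> (sym_power N) (\<lambda>x. sym_action (\<rho> x)))
      = (\<Sum>\<nu>\<in>?I. qpow \<nu> ^ N *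
          (\<Sum>k = 1..m \<nu>. A \<nu> k * ratfun_const (of_rat (poly (binomial_poly k) (of_nat N)))))" for N
  proof -
    have "laurent_to_ratfun (character r h \<omega> (sym_power N) (\<lambda>x. sym_action (\<rho> x)))
        = (\<Sum>M\<in>multisets_over B N. \<Prod>e\<in>#M. qpow (c e))"
      by (rule character_sym_power[OF lin B c e fundamental co])
    also have "\<dots> = (\<Sum>\<nu>\<in>c ` B. qpow \<nu> ^ N * (\<Sum>k=1..m \<nu>.
        expansion_coeff (qpow \<nu>) (Fract 1 (P \<nu>)) (m \<nu> - k) * of_nat ((N + k - 1) choose N)))"
      unfolding P_def
      using B(1) ne c inj_qpow qpow_nonzero m
      by (intro complete_homogeneous_partial_fractions) (auto simp: X_def intro: inj_on_subset)
    also have "\<dots> = (\<Sum>\<nu>\<in>?I. qpow \<nu> ^ N *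
        (\<Sum>k = 1..m \<nu>. A \<nu> k * ratfun_const (of_rat (poly (binomial_poly k) (of_nat N)))))"
      unfolding I[symmetric]
    proof (intro sum.cong refl arg_cong2[where f = "(*)"])
      show "expansion_coeff (qpow \<nu>) (Fract 1 (P \<nu>)) (m \<nu> - k) = A \<nu> k" for \<nu> k
        unfolding A_def f_eq ..
      show "of_nat ((N + k - 1) choose N) = ratfun_const (of_rat (poly (binomial_poly k) (of_nat N)))"
        if "k \<in> {1..m \<nu>}" for k \<nu>
        using that by (simp add: poly_binomial_poly ratfun_const_of_nat)
    qed
    finally show ?thesis .
  qed
  moreover have "A \<mu> (m \<mu> - l) = (- 1) ^ l / (of_nat (fact l) * qpow \<mu> ^ l) *
      fract_eval ((fract_deriv ^^ l) (?f \<mu>)) (inverse (qpow \<mu>))" if "l < m \<mu>" for \<mu> l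
    using that by (simp add: A_def expansion_coeff_def)
  ultimately show "\<exists>A :: weight \<Rightarrow> nat \<Rightarrow> ratfun.
      (\<forall>\<nu>\<in>X. \<forall>k\<in>{1..m \<nu>}. A \<nu> k \<in> rational_functions r) \<and>
      (\<forall>N::nat.
        laurent_to_ratfun (character r h \<omega> (sym_power N) (\<lambda>x. sym_action (\<rho> x)))
          = (\<Sum>\<nu> | \<nu> \<in> X \<and> m \<nu> \<noteq> 0. qpow \<nu> ^ N *
              (\<Sum>k = 1..m \<nu>. A \<nu> k * ratfun_const (of_rat (poly (binomial_poly k) (of_nat N)))))) \<and>
      (\<forall>\<mu>\<in>X. \<forall>l<m \<mu>.
        A \<mu> (m \<mu> - l) = (- 1) ^ l / (of_nat (fact l) * qpow \<mu> ^ l) *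
          fract_eval
            ((fract_deriv ^^ l)
              (\<Prod>\<nu> \<in> {\<nu> \<in> X. m \<nu> \<noteq> 0} - {\<mu>}. 1 / (Fract [:1, - qpow \<nu>:] 1) ^ m \<nu>))
            (inverse (qpow \<mu>)))"
    by (intro exI[of _ A] conjI ballI allI impI)
qed

end
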